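(* The problem Quasi-Kernel restricted to biorientations $D$ of split graphs is fixed-parameter tractable (FPT) for the parameter $|K(D)|$, and it is also fixed-parameter tractable for the parameter $|I(D)|$.
   Context: Quasi-Kernel is the following decision problem: given a digraph $D$ and an integer $q$, decide whether $D$ has a quasi-kernel of size at most $q$. A quasi-kernel of a digraph $D$ is an independent set $Q\subseteq V(D)$ (no arc between any two vertices of $Q$) such that from every vertex of $D$ there is a directed path of length at most two to some vertex of $Q$ (length zero for vertices of $Q$). A split graph is an undirected graph whose vertex set can be partitioned into a clique and an independent set. A biorientation of an undirected graph is a digraph obtained by replacing each edge $uv$ by the single arc $(u,v)$, or the single arc $(v,u)$, or both arcs. For a biorientation $D$ of a split graph, $K(D)$ denotes the set of vertices in the clique part and $I(D)$ the set of vertices in the independent part. A parameterized problem is FPT for a parameter $p$ if it is solvable in time $f(p)\cdot n^{O(1)}$ for some computable function $f$, where $n$ is the input size. *)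

theory Defs
  imports "Graph_Theory.Graph_Theory"
begin

section \<open>Digraphs, split graphs, quasi-kernels\<close>

text \<open>
  Digraphs without parallel arcs are elements of \<^typ>\<open>'a pair_pre_digraph\<close>; as usual in
  \<open>Graph_Theory\<close>, a finite simple undirected graph is a symmetric loop-free one
  (\<^const>\<open>pair_graph\<close>), an edge being represented by its two arcs.
\<close>

definition split_partition :: "'a pair_pre_digraph \<Rightarrow> 'a set \<Rightarrow> 'a set \<Rightarrow> bool" where
  "split_partition G K I \<longleftrightarrow>
     K \<union> I = pverts G \<and> K \<inter> I = {} \<and>
     (\<forall>u\<in>K. \<forall>v\<in>K. u \<noteq> v \<longrightarrow> (u, v) \<in> parcs G) \<and>
     (\<forall>u\<in>I. \<forall>v\<in>I. (u, v) \<notin> parcs G)"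

definition split_graph :: "'a pair_pre_digraph \<Rightarrow> bool" where
  "split_graph G \<longleftrightarrow> pair_graph G \<and> (\<exists>K I. split_partition G K I)"

definition biorientation :: "'a pair_pre_digraph \<Rightarrow> 'a pair_pre_digraph \<Rightarrow> bool" where
  "biorientation G D \<longleftrightarrow>
     pverts D = pverts G \<and>
     (\<forall>u v. (u, v) \<in> parcs G \<longleftrightarrow> (u, v) \<in> parcs D \<or> (v, u) \<in> parcs D)"

definition quasi_kernel :: "'a pair_pre_digraph \<Rightarrow> 'a set \<Rightarrow> bool" where
  "quasi_kernel D Q \<longleftrightarrow>
     Q \<subseteq> pverts D \<and>
     (\<forall>u\<in>Q. \<forall>v\<in>Q. (u, v) \<notin> parcs D) \<and>
     (\<forall>v\<in>pverts D. \<exists>w\<in>Q. \<exists>p. pre_digraph.apath (with_proj D) v p w \<and> length p \<le> 2)"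

section \<open>Machine model\<close>

text \<open>
  Running times refer to a first-order, call-by-value functional language over binary trees
  (the language F of N. D. Jones, \<open>Computability and Complexity from a Programming
  Perspective\<close>, 1997), in which every elementary operation (constructing a node, selecting a
  subtree, testing for a leaf, calling a function) costs one unit.  With trees represented by
  pointers each such operation takes constant time, so this cost measure is polynomially
  related to the running time of Turing machines.
\<close>

datatype tree = Leaf | Node tree tree

fun left :: "tree \<Rightarrow> tree" where
  "left Leaf = Leaf"
| "left (Node l r) = l"

fun right :: "tree \<Rightarrow> tree" where
  "right Leaf = Leaf"
| "right (Node l r) = r"

fun tree_size :: "tree \<Rightarrow> nat" where
  "tree_size Leaf = 1"
| "tree_size (Node l r) = 1 + tree_size l + tree_size r"

text \<open>
  A program is a list of function bodies.  Every function has a single parameter, denoted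
  \<open>Arg\<close>; \<open>Call i e\<close> applies the \<open>i\<close>-th function to the value of \<open>e\<close>; \<open>If\<close> takes its first
  branch iff the test does not evaluate to \<open>Leaf\<close>.
\<close>

datatype expr =
    Arg
  | LeafE
  | NodeE expr expr
  | LeftE expr
  | RightE expr
  | IfE expr expr expr
  | Call nat expr

type_synonym program = "expr list"

text \<open>\<open>evals P x e v t\<close>: with \<open>Arg\<close> bound to \<open>x\<close>, \<open>e\<close> evaluates to \<open>v\<close> in time \<open>t\<close>.\<close>

inductive evals :: "program \<Rightarrow> tree \<Rightarrow> expr \<Rightarrow> tree \<Rightarrow> nat \<Rightarrow> bool" for P :: program where
  Arg: "evals P x Arg x 1"
| Leaf: "evals P x LeafE Leaf 1"
| Node: "evals P x e1 v1 t1 \<Longrightarrow> evals P x e2 v2 t2 \<Longrightarrow>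
    evals P x (NodeE e1 e2) (Node v1 v2) (t1 + t2 + 1)"
| Left: "evals P x e v t \<Longrightarrow> evals P x (LeftE e) (left v) (t + 1)"
| Right: "evals P x e v t \<Longrightarrow> evals P x (RightE e) (right v) (t + 1)"
| IfTrue: "evals P x e1 v1 t1 \<Longrightarrow> v1 \<noteq> Leaf \<Longrightarrow> evals P x e2 v t2 \<Longrightarrow>
    evals P x (IfE e1 e2 e3) v (t1 + t2 + 1)"
| IfFalse: "evals P x e1 Leaf t1 \<Longrightarrow> evals P x e3 v t3 \<Longrightarrow>
    evals P x (IfE e1 e2 e3) v (t1 + t3 + 1)"
| Call: "evals P x e w t1 \<Longrightarrow> i < length P \<Longrightarrow> evals P w (P ! i) v t2 \<Longrightarrow>
    evals P x (Call i e) v (t1 + t2 + 1)"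

lemma evals_deterministic:
  "evals P x e v t \<Longrightarrow> evals P x e v' t' \<Longrightarrow> v = v' \<and> t = t'"
proof (induction arbitrary: v' t' rule: evals.induct)
  case (Node x e1 v1 t1 e2 v2 t2)
  from Node.prems show ?case by cases (use Node.IH in blast)
next
  case (Left x e v t)
  from Left.prems show ?case by cases (use Left.IH in blast)
next
  case (Right x e v t)
  from Right.prems show ?case by cases (use Right.IH in blast)
next
  case (IfTrue x e1 v1 t1 e2 v t2 e3)
  from IfTrue.prems show ?case by cases (use IfTrue.IH IfTrue.hyps in blast)+
next
  case (IfFalse x e1 t1 e3 v t3 e2)
  from IfFalse.prems show ?case by cases (use IfFalse.IH in blast)+
next
  case (Call x e w t1 i v t2)
  from Call.prems show ?case by cases (use Call.IH in blast)
qed (auto elim: evals.cases)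

text \<open>Execution starts with the first function of the program.\<close>

definition computes_in :: "program \<Rightarrow> tree \<Rightarrow> tree \<Rightarrow> nat \<Rightarrow> bool" where
  "computes_in P x v t \<longleftrightarrow> evals P x (Call 0 Arg) v t"

section \<open>Encodings\<close>

fun list_tree :: "tree list \<Rightarrow> tree" where
  "list_tree [] = Leaf"
| "list_tree (x # xs) = Node x (list_tree xs)"

definition bool_tree :: "bool \<Rightarrow> tree" where
  "bool_tree b = (if b then Node Leaf Leaf else Leaf)"

definition unary_tree :: "nat \<Rightarrow> tree" where
  "unary_tree n = list_tree (replicate n Leaf)"

text \<open>Binary digits, least significant digit first.\<close>

fun bits :: "nat \<Rightarrow> bool list" where
  "bits n = (if n = 0 then [] else odd n # bits (n div 2))"

declare bits.simps [simp del]

definition int_tree :: "int \<Rightarrow> tree" where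
  "int_tree q = Node (bool_tree (q < 0)) (list_tree (map bool_tree (bits (nat \<bar>q\<bar>))))"

text \<open>
  A digraph is encoded by its adjacency matrix (a list of rows), with rows and columns in
  increasing order of the vertices.
\<close>

definition digraph_tree :: "nat pair_pre_digraph \<Rightarrow> tree" where
  "digraph_tree D =
     (let vs = sorted_list_of_set (pverts D)
      in list_tree (map (\<lambda>u. list_tree (map (\<lambda>v. bool_tree ((u, v) \<in> parcs D)) vs)) vs))"

section \<open>Fixed-parameter tractability\<close>

definition computable_fun :: "(nat \<Rightarrow> nat) \<Rightarrow> bool" where
  "computable_fun f \<longleftrightarrow> (\<exists>P. \<forall>k. \<exists>t. computes_in P (unary_tree k) (unary_tree (f k)) t)"

text \<open>
  The problem: given an instance \<open>x\<close>, encoded as \<open>enc x\<close> and promised to lie in \<open>inst\<close>, decide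
  whether \<open>yes x\<close> holds.  The parameter \<open>\<kappa> x\<close> is not part of the input.
\<close>

definition fpt :: "('i \<Rightarrow> tree) \<Rightarrow> 'i set \<Rightarrow> ('i \<Rightarrow> bool) \<Rightarrow> ('i \<Rightarrow> nat) \<Rightarrow> bool" where
  "fpt enc inst yes \<kappa> \<longleftrightarrow>
     (\<exists>P f c. computable_fun f \<and>
        (\<forall>x\<in>inst. \<exists>t. computes_in P (enc x) (bool_tree (yes x)) t \<and>
                       t \<le> f (\<kappa> x) * tree_size (enc x) ^ c))"

section \<open>Quasi-Kernel on biorientations of split graphs\<close>

type_synonym qk_instance = "nat pair_pre_digraph \<times> int"

definition qk_tree :: "qk_instance \<Rightarrow> tree" where
  "qk_tree = (\<lambda>(D, q). Node (digraph_tree D) (int_tree q))"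

definition has_small_qk :: "qk_instance \<Rightarrow> bool" where
  "has_small_qk = (\<lambda>(D, q). \<exists>Q. quasi_kernel D Q \<and> int (card Q) \<le> q)"

definition split_instances :: "qk_instance set" where
  "split_instances = {(D, q). \<exists>G. split_graph G \<and> biorientation G D}"

end

theory Submission
  imports Defs
begin

text \<open>
  One program serves both parameters.  Call two vertices twins if they have the same in- and
  out-neighbours.  A class \<open>T\<close> of twins that meets a quasi-kernel \<open>Q\<close> without being contained
  in it may be replaced in \<open>Q\<close> by any single one of its members, so some smallest quasi-kernel
  contains, of every class, no vertex, a fixed representative, or all vertices.  The program goes
  through the classes, keeps the list of all independent sets obtained from these three choices,
  and tests each of them.

  Vertices of the independent part are twins as soon as they have the same neighbours in the
  clique, so there are at most \<open>k + 4^k\<close> classes for a clique of size \<open>k\<close>, hence at most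
  \<open>3^(k + 4^k)\<close> candidates.  On the other hand, an independent set has at most one vertex in the
  clique, hence there are at most \<open>3^i (1 + 2 n)\<close> candidates for an independent part of size \<open>i\<close>.
\<close>

section \<open>Quasi-kernels and twins\<close>

text \<open>The program sees neither the parameter nor the split partition: its search is correct on
  every finite digraph, and the partition enters only when candidates are counted. The choice of all
  vertices of a class cannot be dropped, since a vertex of a class contained in \<open>Q\<close> may
  be absorbed by nothing but itself. Independence is tested after each class and not once at the
  end: distinct clique vertices of a loop-free digraph are never twins, so unfiltered lists would be
  exponential in the clique even when the independent part is small. The other obstacle is the
  machine model, which demands an actual program with a proven time bound. Apart from one recursive
  loop for folds, no program with control flow of any size is written out; closure rules turn a HOL
  term built from nodes, tests and list folds into a program, with a bound polynomial in the input
  size and one further quantity \<open>B\<close>. Everything except the list of candidates has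
  polynomial size, so \<open>B\<close> becomes the largest size that this list attains during the
  run.\<close>

definition twin :: "('v \<Rightarrow> 'v \<Rightarrow> bool) \<Rightarrow> 'v list \<Rightarrow> 'v \<Rightarrow> 'v \<Rightarrow> bool" where
  "twin A vs u v \<longleftrightarrow> (\<forall>z\<in>set vs. (A u z \<longleftrightarrow> A v z) \<and> (A z u \<longleftrightarrow> A z v))"

definition reps :: "('v \<Rightarrow> 'v \<Rightarrow> bool) \<Rightarrow> 'v list \<Rightarrow> 'v list" where
  "reps A vs = foldr (\<lambda>v R. if \<exists>u\<in>set R. twin A vs u v then R else v # R) vs []"

definition indep :: "('v \<Rightarrow> 'v \<Rightarrow> bool) \<Rightarrow> 'v set \<Rightarrow> bool" where
  "indep A S \<longleftrightarrow> (\<forall>u\<in>S. \<forall>v\<in>S. \<not> A u v)"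

definition absorbs :: "('v \<Rightarrow> 'v \<Rightarrow> bool) \<Rightarrow> 'v set \<Rightarrow> 'v set \<Rightarrow> bool" where
  "absorbs A V S \<longleftrightarrow> (\<forall>v\<in>V. \<exists>w\<in>S. v = w \<or> A v w \<or> (\<exists>z\<in>V. A v z \<and> A z w))"

definition extend :: "('v \<Rightarrow> 'v \<Rightarrow> bool) \<Rightarrow> 'v list \<Rightarrow> 'v \<Rightarrow> 'v list list \<Rightarrow> 'v list list" where
  "extend A vs v L = L @ filter (\<lambda>S. indep A (set S)) (map (Cons v) L)
     @ filter (\<lambda>S. indep A (set S)) (map (append (filter (twin A vs v) vs)) L)"

definition cands :: "('v \<Rightarrow> 'v \<Rightarrow> bool) \<Rightarrow> 'v list \<Rightarrow> 'v list \<Rightarrow> 'v list list" where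
  "cands A vs rs = foldr (extend A vs) rs [[]]"

lemma twin_refl [simp]: "twin A vs v v"
  by (simp add: twin_def)

lemma twin_sym: "twin A vs u v \<Longrightarrow> twin A vs v u"
  by (auto simp: twin_def)

lemma twin_trans: "twin A vs u v \<Longrightarrow> twin A vs v w \<Longrightarrow> twin A vs u w"
  by (auto simp: twin_def)

text \<open>As \<open>twin\<close> is symmetric, an order condition on positions expresses that
  entries are pairwise no twins, in a form suited to list induction.\<close>

abbreviation untwinned :: "('v \<Rightarrow> 'v \<Rightarrow> bool) \<Rightarrow> 'v list \<Rightarrow> 'v list \<Rightarrow> bool" where
  "untwinned A vs \<equiv> sorted_wrt (\<lambda>u v. \<not> twin A vs u v)"

abbreviation tclass :: "('v \<Rightarrow> 'v \<Rightarrow> bool) \<Rightarrow> 'v list \<Rightarrow> 'v \<Rightarrow> 'v set" where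
  "tclass A vs v \<equiv> {u \<in> set vs. twin A vs v u}"

lemma untwinned_distinct: "untwinned A vs rs \<Longrightarrow> distinct rs"
  by (induction rs) auto

lemma tclass_disjoint: "\<not> twin A vs u v \<Longrightarrow> tclass A vs u \<inter> tclass A vs v = {}"
  using twin_sym twin_trans by fast

lemma tclass_Union_disjoint:
  assumes "untwinned A vs (v # rs)"
  shows "tclass A vs v \<inter> (\<Union>u\<in>set rs. tclass A vs u) = {}"
proof -
  have "tclass A vs v \<inter> tclass A vs u = {}" if "u \<in> set rs" for u
    by (rule tclass_disjoint) (use assms that in simp)
  then show ?thesis by blast
qed

lemma reps:
  shows reps_subset: "set (reps A vs) \<subseteq> set vs"
    and reps_untwinned: "untwinned A vs (reps A vs)"
    and reps_cover: "(\<Union>v\<in>set (reps A vs). tclass A vs v) = set vs"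
proof -
  let ?r = "\<lambda>xs. foldr (\<lambda>v R. if \<exists>u\<in>set R. twin A vs u v then R else v # R) xs []"
  \<comment> \<open>The list being folded is generalised to \<open>xs\<close>, while twins remain
    twins with respect to the fixed \<open>vs\<close>.\<close>
  have *: "set (?r xs) \<subseteq> set xs \<and> untwinned A vs (?r xs) \<and> (\<forall>v\<in>set xs. \<exists>u\<in>set (?r xs). twin A vs u
    v)" for xs
  proof (induction xs)
    case (Cons x xs)
    show ?case
    proof (cases "\<exists>u\<in>set (?r xs). twin A vs u x")
      case True
      then have "?r (x # xs) = ?r xs" by simp
      with True Cons twin_sym show ?thesis by auto
    next
      case False
      then have *: "?r (x # xs) = x # ?r xs" by simp
      have "\<not> twin A vs x u" if "u \<in> set (?r xs)" for u
        using False that twin_sym by fast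
      with Cons show ?thesis unfolding * by auto
    qed
  qed simp
  show "set (reps A vs) \<subseteq> set vs" "untwinned A vs (reps A vs)"
    "(\<Union>v\<in>set (reps A vs). tclass A vs v) = set vs"
    using *[of vs] unfolding reps_def by blast+
qed

text \<open>
  If a class \<open>T\<close> of twins is neither contained in nor disjoint from a quasi-kernel \<open>Q\<close>, some member
  of \<open>T\<close> reaches \<open>Q\<close> by a path of length one or two; so do all its twins, and a single vertex of
  \<open>T\<close> suffices.
\<close>

lemma absorbs_exchange:
  assumes v: "v \<in> set vs" and Q: "Q \<subseteq> set vs" "indep A Q" "absorbs A (set vs) Q"
  obtains Q' where "Q' \<subseteq> set vs" "indep A Q'" "absorbs A (set vs) Q'" "card Q' \<le> card Q"
    "Q' \<inter> tclass A vs v \<in> {{}, {v}, tclass A vs v}" "Q' - tclass A vs v = Q - tclass A vs v"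
proof (cases "Q \<inter> tclass A vs v \<in> {{}, {v}, tclass A vs v}")
  case True
  then show thesis using that[of Q] Q by simp
next
  case False
  let ?T = "tclass A vs v"
  let ?Q' = "insert v (Q - ?T)"
  have vT: "v \<in> ?T" using v by simp
  obtain a where a: "a \<in> Q" "a \<in> ?T" using False by auto
  obtain b where b: "b \<notin> Q" "b \<in> ?T" using False by auto
  have tw: "twin A vs x y" if "x \<in> ?T" "y \<in> ?T" for x y
    using that twin_sym twin_trans by fast
  have in_iff: "A z x \<longleftrightarrow> A z y" and out_iff: "A x z \<longleftrightarrow> A y z"
    if "x \<in> ?T" "y \<in> ?T" "z \<in> set vs" for x y z
    using tw[OF that(1,2)] that(3) by (auto simp: twin_def)
  \<comment> \<open>A path of positive length ending in the class can be redirected to end in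
    \<open>v\<close>, because twins share their in-neighbours.\<close>
  have move: "\<exists>w'\<in>?Q'. A u w' \<or> (\<exists>z\<in>set vs. A u z \<and> A z w')"
    if "w \<in> Q" "u \<in> set vs" "A u w \<or> (\<exists>z\<in>set vs. A u z \<and> A z w)" for u w
  proof (cases "w \<in> ?T")
    case True
    then have "A z w \<longleftrightarrow> A z v" if "z \<in> set vs" for z using in_iff[OF _ vT that] by blast
    then show ?thesis using that by blast
  next
    case False then show ?thesis using that by blast
  qed
  show thesis
  proof (rule that[of ?Q'])
    show "?Q' \<subseteq> set vs" using v Q(1) by auto
    have "A v z \<longleftrightarrow> A a z" "A z v \<longleftrightarrow> A z a" if "z \<in> set vs" for z
      using in_iff[OF a(2) vT that] out_iff[OF a(2) vT that] by auto
    moreover have "\<not> A a z" "\<not> A z a" if "z \<in> Q" for z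
      using Q(2) a(1) that unfolding indep_def by auto
    ultimately have "\<not> A v z \<and> \<not> A z v" if "z \<in> Q" for z using that Q(1) by blast
    \<comment> \<open>\<open>v\<close> may lie outside \<open>Q\<close>, so the absence of a loop is
      copied from \<open>a\<close>: \<open>A v v\<close>, \<open>A a v\<close> and
      \<open>A a a\<close> are equivalent.\<close>
    moreover have "\<not> A v v"
      using \<open>\<And>z. z \<in> set vs \<Longrightarrow> A v z = A a z\<close>[OF v] in_iff[OF vT a(2), of a] Q(1,2) a(1)
      unfolding indep_def by blast
    ultimately show "indep A ?Q'" using Q(2) unfolding indep_def by blast
    show "card ?Q' \<le> card Q"
    proof -
      have fin: "finite Q" using Q(1) finite_subset by blast
      have "card ?Q' \<le> Suc (card (Q - ?T))" by (rule card_insert_le_m1) (simp_all add: fin)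
      also have "\<dots> \<le> Suc (card (Q - {a}))" using a fin by (intro Suc_le_mono[THEN iffD2] card_mono) auto
      also have "\<dots> = card Q" using a fin by (metis card.remove)
      finally show ?thesis .
    qed
    show "absorbs A (set vs) ?Q'" unfolding absorbs_def
    proof
      fix u assume u: "u \<in> set vs"
      show "\<exists>w\<in>?Q'. u = w \<or> A u w \<or> (\<exists>z\<in>set vs. A u z \<and> A z w)"
      proof (cases "u \<in> ?T")
        case True
        obtain w where "w \<in> Q" "b = w \<or> A b w \<or> (\<exists>z\<in>set vs. A b z \<and> A z w)"
          using Q(3) b(2) unfolding absorbs_def by blast
        \<comment> \<open>Since \<open>b\<close> is outside \<open>Q\<close>, its path has a first
          arc, and the head of that arc is also an out-neighbour of the twin
          \<open>u\<close>.\<close>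
        then have w: "w \<in> Q" "A b w \<or> (\<exists>z\<in>set vs. A b z \<and> A z w)" using b(1) by auto
        then have "A u w \<or> (\<exists>z\<in>set vs. A u z \<and> A z w)"
          using out_iff[OF True b(2)] Q(1) by blast
        then show ?thesis using move[OF w(1) u] by blast
      next
        case False
        obtain w where w: "w \<in> Q" "u = w \<or> A u w \<or> (\<exists>z\<in>set vs. A u z \<and> A z w)"
          using Q(3) u unfolding absorbs_def by blast
        then show ?thesis using move[OF w(1) u] False by blast
      qed
    qed
  qed (use v in auto)
qed

text \<open>Exchanges in different classes do not interfere: classes are disjoint, and an exchange
  changes \<open>Q\<close> only inside its own class.\<close>

lemma absorbs_normalise:
  assumes "untwinned A vs rs" "set rs \<subseteq> set vs" "Q \<subseteq> set vs" "indep A Q" "absorbs A (set vs) Q"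
  obtains Q' where "Q' \<subseteq> set vs" "indep A Q'" "absorbs A (set vs) Q'" "card Q' \<le> card Q"
    "\<forall>v\<in>set rs. Q' \<inter> tclass A vs v \<in> {{}, {v}, tclass A vs v}"
  using assms
proof (induction rs arbitrary: thesis)
  case Nil
  then show ?case by auto
next
  case (Cons v rs)
  obtain Q1 where Q1: "Q1 \<subseteq> set vs" "indep A Q1" "absorbs A (set vs) Q1" "card Q1 \<le> card Q"
    "\<forall>v\<in>set rs. Q1 \<inter> tclass A vs v \<in> {{}, {v}, tclass A vs v}"
    by (rule Cons.IH) (use Cons.prems in auto)
  obtain Q' where Q': "Q' \<subseteq> set vs" "indep A Q'" "absorbs A (set vs) Q'" "card Q' \<le> card Q1"
    "Q' \<inter> tclass A vs v \<in> {{}, {v}, tclass A vs v}" "Q' - tclass A vs v = Q1 - tclass A vs v"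
    using absorbs_exchange[of v vs Q1 A] Cons.prems(3) Q1(1-3) by auto
  have "Q' \<inter> tclass A vs u = Q1 \<inter> tclass A vs u" if "u \<in> set rs" for u
  proof -
    have "\<not> twin A vs v u" using Cons.prems(2) that by simp
    from tclass_disjoint[OF this] Q'(6) show ?thesis by blast
  qed
  then show ?case using Cons.prems(1)[of Q'] Q' Q1(4,5) by simp
qed

lemma set_extend:
  "S \<in> set (extend A vs v L) \<longleftrightarrow> S \<in> set L \<or> indep A (set S) \<and>
     (\<exists>S'\<in>set L. S = v # S' \<or> S = filter (twin A vs v) vs @ S')"
  by (auto simp: extend_def)

lemma indep_mono: "indep A S \<Longrightarrow> S' \<subseteq> S \<Longrightarrow> indep A S'"
  unfolding indep_def by blast

text \<open>The trace of \<open>Q\<close> on the classes treated so far is always among the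
  candidates; as a subset of \<open>Q\<close> it is independent and survives every filter.\<close>

lemma cands_complete:
  assumes "untwinned A vs rs" "distinct vs" "set rs \<subseteq> set vs" "indep A Q"
    "\<forall>v\<in>set rs. Q \<inter> tclass A vs v \<in> {{}, {v}, tclass A vs v}"
  shows "\<exists>S\<in>set (cands A vs rs). distinct S \<and> set S = Q \<inter> (\<Union>v\<in>set rs. tclass A vs v)"
  using assms
proof (induction rs)
  case Nil
  then show ?case by (simp add: cands_def)
next
  case (Cons v rs)
  let ?T = "tclass A vs v" and ?U = "\<Union>v\<in>set rs. tclass A vs v"
  obtain S where S: "S \<in> set (cands A vs rs)" "distinct S" "set S = Q \<inter> ?U"
  proof -
    have "\<exists>S\<in>set (cands A vs rs). distinct S \<and> set S = Q \<inter> ?U"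
      by (rule Cons.IH) (use Cons.prems in simp_all)
    then show thesis using that by blast
  qed
  have disj: "?T \<inter> ?U = {}" using tclass_Union_disjoint[OF Cons.prems(1)] .
  have eq: "Q \<inter> (\<Union>v\<in>set (v # rs). tclass A vs v) = Q \<inter> ?T \<union> set S"
    unfolding S(3) by (simp add: Int_Un_distrib)
  have c: "cands A vs (v # rs) = extend A vs v (cands A vs rs)" by (simp add: cands_def)
  have ind: "indep A (Q \<inter> ?T \<union> set S)" 
    by (rule indep_mono[OF Cons.prems(4)]) (simp add: S(3))
  have vT: "v \<in> ?T" using Cons.prems(3) by simp
  have "Q \<inter> ?T \<in> {{}, {v}, ?T}" using Cons.prems(5) by (rule bspec) simp
  then consider "Q \<inter> ?T = {}" | "Q \<inter> ?T = {v}" | "Q \<inter> ?T = ?T"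
    unfolding insert_iff empty_iff by argo
  then show ?case
  proof cases
    case 1
    then show ?thesis unfolding c eq by (intro bexI[of _ S]) (simp_all add: S(1,2) set_extend)
  next
    case 2
    have "v \<notin> set S" using S(3) vT disj by blast
    then have d: "distinct (v # S)" using S(2) by simp
    have e: "set (v # S) = Q \<inter> ?T \<union> set S" unfolding 2 by simp
    have "v # S \<in> set (extend A vs v (cands A vs rs))"
      unfolding set_extend e using S(1) ind by blast
    then show ?thesis unfolding c eq using d e by blast
  next
    case 3
    let ?S = "filter (twin A vs v) vs @ S"
    have "?T \<inter> set S = {}" using S(3) disj by blast
    then have d: "distinct ?S" using S(2) Cons.prems(2) by (simp add: Int_def conj_commute)
    have e: "set ?S = Q \<inter> ?T \<union> set S" unfolding 3 by simp
    have "?S \<in> set (extend A vs v (cands A vs rs))"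
      unfolding set_extend e using S(1) ind by blast
    then show ?thesis unfolding c eq using d e by blast
  qed
qed

text \<open>New vertices come from a class disjoint from all earlier ones, so nothing is repeated.
  Distinctness later bounds the length of a candidate, and with it the size of its encoding.\<close>

lemma cands_sound:
  assumes "untwinned A vs rs" "distinct vs" "set rs \<subseteq> set vs" "S \<in> set (cands A vs rs)"
  shows "distinct S \<and> set S \<subseteq> (\<Union>v\<in>set rs. tclass A vs v)"
  using assms
proof (induction rs arbitrary: S)
  case Nil
  then show ?case by (simp add: cands_def)
next
  case (Cons v rs)
  have c: "cands A vs (v # rs) = extend A vs v (cands A vs rs)" by (simp add: cands_def)
  have disj: "tclass A vs v \<inter> (\<Union>v\<in>set rs. tclass A vs v) = {}"
    by (rule tclass_Union_disjoint[OF Cons.prems(1)])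
  have vT: "v \<in> tclass A vs v" using Cons.prems(3) by simp
  have IH: "distinct S' \<and> set S' \<subseteq> (\<Union>v\<in>set rs. tclass A vs v)" if "S' \<in> set (cands A vs rs)" for S'
    using Cons.IH[OF _ _ _ that] Cons.prems by simp
  from Cons.prems(4) consider "S \<in> set (cands A vs rs)"
    | S' where "S' \<in> set (cands A vs rs)" "S = v # S'"
    | S' where "S' \<in> set (cands A vs rs)" "S = filter (twin A vs v) vs @ S'"
    unfolding c set_extend by blast
  then show ?case
  proof cases
    case 1 then show ?thesis using IH[of S] by simp blast
  next
    case 2
    then have "v \<notin> set S'" using IH[of S'] disj vT by blast
    with 2 show ?thesis using IH[of S'] vT by simp blast
  next
    case 3
    then have "tclass A vs v \<inter> set S' = {}" using IH[of S'] disj by blast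
    then have "distinct S" unfolding 3 using Cons.prems(2) IH[OF 3(1)] by (simp add: Int_def
      conj_commute)
    moreover have "set S = tclass A vs v \<union> set S'" unfolding 3 by auto
    ultimately show ?thesis using IH[OF 3(1)] by simp blast
  qed
qed

theorem cands_correct:
  assumes "distinct vs"
  shows "(\<exists>Q\<subseteq>set vs. indep A Q \<and> absorbs A (set vs) Q \<and> card Q \<le> m) \<longleftrightarrow>
    (\<exists>S\<in>set (cands A vs (reps A vs)). indep A (set S) \<and> absorbs A (set vs) (set S) \<and> length S \<le> m)"
    (is "?l \<longleftrightarrow> ?r")
proof
  assume ?l
  then obtain Q where Q: "Q \<subseteq> set vs" "indep A Q" "absorbs A (set vs) Q" "card Q \<le> m" by blast
  show ?r
  proof (rule absorbs_normalise[OF reps_untwinned reps_subset Q(1-3)])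
    fix Q' assume Q': "Q' \<subseteq> set vs" "indep A Q'" "absorbs A (set vs) Q'" "card Q' \<le> card Q"
      "\<forall>v\<in>set (reps A vs). Q' \<inter> tclass A vs v \<in> {{}, {v}, tclass A vs v}"
    have "\<exists>S\<in>set (cands A vs (reps A vs)). distinct S \<and> set S = Q'"
      using cands_complete[OF reps_untwinned assms reps_subset Q'(2,5)] Q'(1)
      unfolding reps_cover by (simp only: Int_absorb2)
    then obtain S where S: "S \<in> set (cands A vs (reps A vs))" "distinct S" "set S = Q'" by blast
    have "length S \<le> m" using Q(4) Q'(4) distinct_card[OF S(2)] unfolding S(3) by simp
    then show ?r using S(1) Q'(2,3) unfolding S(3)[symmetric] by blast
  qed
next
  assume ?r
  then obtain S where S: "S \<in> set (cands A vs (reps A vs))" "indep A (set S)"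
    "absorbs A (set vs) (set S)" "length S \<le> m" by blast
  moreover have "set S \<subseteq> set vs"
    using cands_sound[OF reps_untwinned assms reps_subset S(1)] unfolding reps_cover by blast
  ultimately show ?l using card_length[of S] by (meson le_trans)
qed

lemma cands_elem_length:
  assumes "untwinned A vs rs" "distinct vs" "set rs \<subseteq> set vs" "S \<in> set (cands A vs rs)"
  shows "length S \<le> length vs" "set S \<subseteq> set vs"
proof -
  from cands_sound[OF assms] have S: "distinct S" "set S \<subseteq> set vs" by auto
  then show "length S \<le> length vs" "set S \<subseteq> set vs" using card_mono[of "set vs" "set S"] assms(2)
    by (auto simp: distinct_card)
qed

section \<open>Counting the candidates\<close>

lemma length_extend: "length (extend A vs v L) \<le> 3 * length L"
proof -
  have "length (filter P (map f L)) \<le> length L" for P and f :: "'a list \<Rightarrow> 'a list"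
    using length_filter_le[of P "map f L"] by simp
  then have "length (filter P (map f L)) + length (filter P' (map g L)) \<le> length L + length L"
    for P P' and f g :: "'a list \<Rightarrow> 'a list" by (meson add_le_mono)
  from this[of "\<lambda>S. indep A (set S)" "Cons v" "\<lambda>S. indep A (set S)" "append (filter (twin A vs v) vs)"]
  show ?thesis unfolding extend_def by simp
qed

lemma length_cands: "length (cands A vs rs) \<le> 3 ^ length rs"
proof (induction rs)
  case (Cons v rs)
  have "length (cands A vs (v # rs)) \<le> 3 * length (cands A vs rs)"
    using length_extend by (simp add: cands_def)
  with Cons show ?case by simp
qed (simp add: cands_def)

text \<open>The induction carries two counts, of the candidates avoiding \<open>K\<close> and of all
  candidates. A representative outside \<open>K\<close> at most triples both. A representative in
  \<open>K\<close> can only be added to a candidate avoiding \<open>K\<close>, which yields at most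
  two new candidates for each of these, and none of the new ones avoids \<open>K\<close>.\<close>

lemma length_cands_indep:
  fixes K I :: "'v set"
  assumes clique: "\<And>u v. u \<in> K \<Longrightarrow> v \<in> K \<Longrightarrow> u \<noteq> v \<Longrightarrow> A u v \<or> A v u"
    and "set vs = K \<union> I" "untwinned A vs rs" "distinct vs" "set rs \<subseteq> set vs"
  shows "length (filter (\<lambda>S. set S \<inter> K = {}) (cands A vs rs)) \<le> 3 ^ length (filter (\<lambda>v. v \<notin> K) rs) \<and>
    length (cands A vs rs) \<le> 3 ^ length (filter (\<lambda>v. v \<notin> K) rs) * (1 + 2 * length (filter (\<lambda>v. v \<in>
      K) rs))"
  using assms(3,5)
proof (induction rs)
  case (Cons v rs)
  let ?C = "cands A vs rs" and ?p = "\<lambda>S. set S \<inter> K = {}"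
  let ?i = "length (filter (\<lambda>v. v \<notin> K) rs)" and ?k = "length (filter (\<lambda>v. v \<in> K) rs)"
  have IH: "length (filter ?p ?C) \<le> 3 ^ ?i" "length ?C \<le> 3 ^ ?i * (1 + 2 * ?k)"
    using Cons by auto
  have c: "cands A vs (v # rs) = extend A vs v ?C" by (simp add: cands_def)
  show ?case
  proof (cases "v \<in> K")
    case False
    let ?L = "filter ?p ?C"
    have len: "length (filter q (filter r (map f L))) \<le> length L'"
      if "\<And>S. S \<in> set L \<Longrightarrow> q (f S) \<Longrightarrow> ?p S" "L' = filter ?p L" for q r L' and L :: "'v list list"
        and f :: "'v list \<Rightarrow> 'v list"
      using that(1) unfolding that(2) by (induction L) auto
    have "length (filter ?p (extend A vs v ?C)) \<le> length ?L + length ?L + length ?L"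
      unfolding extend_def filter_append length_append add.assoc
      by (intro add_le_mono len order_refl) auto
    moreover have "length (extend A vs v ?C) \<le> 3 * length ?C" by (rule length_extend)
    ultimately show ?thesis using False IH unfolding c by simp
  next
    case True
    have sub: "S \<in> set ?C \<Longrightarrow> set S \<subseteq> (\<Union>v\<in>set rs. tclass A vs v)" for S
      using cands_sound[of A vs rs S] Cons.prems assms(4) by auto
    have vT: "v \<in> set (filter (twin A vs v) vs)" using Cons.prems by simp
    \<comment> \<open>The clique vertex \<open>u\<close> of \<open>S\<close> lies in the class of a
      representative in \<open>rs\<close>, no twin of \<open>v\<close>; hence
      \<open>u \<noteq> v\<close> and the two are adjacent.\<close>
    have dep: "\<not> indep A (insert v (set S))" if "S \<in> set ?C" "\<not> ?p S" for S
    proof -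
      from that(2) obtain u where u: "u \<in> set S" "u \<in> K" by auto
      have "u \<noteq> v" using sub[OF that(1)] u(1) Cons.prems(1) twin_sym by fastforce
      then show ?thesis using clique[OF u(2) True] u(1) unfolding indep_def by blast
    qed
    have len: "length (filter r (map f L)) \<le> length L'"
      if "\<And>S. S \<in> set L \<Longrightarrow> r (f S) \<Longrightarrow> ?p S" "L' = filter ?p L" for r L' and L :: "'v list list" and
        f :: "'v list \<Rightarrow> 'v list"
      using that(1) unfolding that(2) by (induction L) auto
    have "length (extend A vs v ?C) \<le> length ?C + (length (filter ?p ?C) + length (filter ?p ?C))"
      unfolding extend_def length_append
    proof (intro add_le_mono order_refl len[OF _ refl])
      fix S assume S: "S \<in> set ?C" "indep A (set (v # S))"
      then show "?p S" using dep by auto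
    next
      fix S assume S: "S \<in> set ?C" "indep A (set (filter (twin A vs v) vs @ S))"
      then show "?p S" using dep[OF S(1)] indep_mono[OF S(2), of "insert v (set S)"] vT by auto
    qed
    moreover have "filter ?p (extend A vs v ?C) = filter ?p ?C"
    proof -
      have "filter ?p (filter r (map f L)) = []" if "\<And>S. v \<in> set (f S)" for r L and f ::
        "'v list \<Rightarrow> 'v list"
        using that True by (induction L) auto
      from this[of "Cons v"] this[of "append (filter (twin A vs v) vs)"] vT
      show ?thesis unfolding extend_def filter_append by auto
    qed
    ultimately show ?thesis using True IH unfolding c by (simp add: algebra_simps)
  qed
qed (simp add: cands_def)

lemma length_untwinned_clique:
  fixes K I :: "'v set"
  assumes "\<And>u v. u \<in> I \<Longrightarrow> v \<in> I \<Longrightarrow> \<not> A u v" "set vs = K \<union> I" "untwinned A vs rs" "set rs \<subseteq> set vs"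
  shows "length rs \<le> card K + 4 ^ card K"
proof -
  have fin: "finite K" by (metis assms(2) List.finite_set finite_Un)
  \<comment> \<open>Out- and in-neighbours in \<open>K\<close> are two independent subsets of
    \<open>K\<close>, hence \<open>2 ^ card K * 2 ^ card K\<close> possible values and the base
    4.\<close>
  let ?f = "\<lambda>v. ({z \<in> K. A v z}, {z \<in> K. A z v})"
  have unt: "\<not> twin A vs u v" if "u \<in> set rs" "v \<in> set rs" "u \<noteq> v" for u v
    using assms(3) that by (induction rs) (auto dest: twin_sym)
  have "inj_on ?f (set rs - K)"
  proof (rule inj_onI)
    fix u v assume uv: "u \<in> set rs - K" "v \<in> set rs - K" "?f u = ?f v"
    have "twin A vs u v" unfolding twin_def
    proof
      fix z assume "z \<in> set vs"
      moreover have "u \<in> I" "v \<in> I" using uv assms(2,4) by auto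
      ultimately show "(A u z \<longleftrightarrow> A v z) \<and> (A z u \<longleftrightarrow> A z v)"
        using uv(3) assms(1,2) by blast
    qed
    then show "u = v" using unt uv by blast
  qed
  then have "card (set rs - K) \<le> card (Pow K \<times> Pow K)"
    by (rule card_inj_on_le) (use fin in auto)
  also have "\<dots> = 4 ^ card K" using fin
    by (simp add: card_cartesian_product card_Pow flip: power_mult_distrib)
  finally have 1: "card (set rs - K) \<le> 4 ^ card K" .
  have "length rs = card (set rs)" using untwinned_distinct[OF assms(3)] by (simp add: distinct_card)
  also have "\<dots> \<le> card (set rs - K) + card (set rs \<inter> K)"
    by (metis card_Un_le Un_Diff_Int)
  also have "card (set rs \<inter> K) \<le> card K" using fin by (simp add: card_mono)
  finally show ?thesis using 1 by simp
qed

section \<open>Composing programs\<close>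

text \<open>Upper bounds replace exact times, so that both branches of a test can share one
  bound.\<close>

definition runs :: "program \<Rightarrow> tree \<Rightarrow> expr \<Rightarrow> tree \<Rightarrow> nat \<Rightarrow> bool" where
  "runs P x e v T \<longleftrightarrow> (\<exists>t\<le>T. evals P x e v t)"

lemma runs_mono: "runs P x e v T \<Longrightarrow> T \<le> T' \<Longrightarrow> runs P x e v T'"
  unfolding runs_def using le_trans by blast

lemma runs_Arg: "runs P x Arg x 1"
  unfolding runs_def using evals.Arg by blast

lemma runs_LeafE: "runs P x LeafE Leaf 1"
  unfolding runs_def using evals.Leaf by blast

lemma runs_NodeE:
  "runs P x e1 v1 T1 \<Longrightarrow> runs P x e2 v2 T2 \<Longrightarrow> runs P x (NodeE e1 e2) (Node v1 v2) (T1 + T2 + 1)"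
  unfolding runs_def by (meson add_le_mono evals.Node order_refl)

lemma runs_LeftE: "runs P x e v T \<Longrightarrow> runs P x (LeftE e) (left v) (T + 1)"
  unfolding runs_def by (meson add_le_mono evals.Left order_refl)

lemma runs_RightE: "runs P x e v T \<Longrightarrow> runs P x (RightE e) (right v) (T + 1)"
  unfolding runs_def by (meson add_le_mono evals.Right order_refl)

lemma runs_IfE:
  assumes "runs P x e1 v1 T1" "v1 \<noteq> Leaf \<Longrightarrow> runs P x e2 v T2" "v1 = Leaf \<Longrightarrow> runs P x e3 v T2"
  shows "runs P x (IfE e1 e2 e3) v (T1 + T2 + 1)"
proof (cases "v1 = Leaf")
  case True
  then show ?thesis using assms(1,3) unfolding runs_def
    by (meson add_le_mono evals.IfFalse order_refl)
next
  case False
  then show ?thesis using assms(1,2) unfolding runs_def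
    by (meson add_le_mono evals.IfTrue order_refl)
qed

lemma runs_Call:
  "runs P x e w T1 \<Longrightarrow> i < length P \<Longrightarrow> runs P w (P ! i) v T2 \<Longrightarrow> runs P x (Call i e) v (T1 + T2 + 1)"
  unfolding runs_def by (meson add_le_mono evals.Call order_refl)

text \<open>Calls refer to absolute positions in the program, so code placed behind \<open>n\<close>
  other functions needs all its indices raised by \<open>n\<close>.\<close>

fun shift :: "nat \<Rightarrow> expr \<Rightarrow> expr" where
  "shift n Arg = Arg"
| "shift n LeafE = LeafE"
| "shift n (NodeE a b) = NodeE (shift n a) (shift n b)"
| "shift n (LeftE a) = LeftE (shift n a)"
| "shift n (RightE a) = RightE (shift n a)"
| "shift n (IfE a b c) = IfE (shift n a) (shift n b) (shift n c)"
| "shift n (Call i a) = Call (n + i) (shift n a)"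

lemma evals_shift:
  "evals P x e v t \<Longrightarrow> evals (Q @ map (shift (length Q)) P @ R) x (shift (length Q) e) v t"
proof (induction rule: evals.induct)
  case (Call x e w t1 i v t2)
  show ?case unfolding shift.simps
    by (rule evals.Call[OF Call.IH(1)]) (use Call in \<open>simp_all add: nth_append\<close>)
qed (simp_all only: shift.simps, (rule evals.intros; assumption)+)

text \<open>The program must be right on all trees, not only on well-formed encodings; composition
  then has no side conditions.\<close>

definition timed :: "(tree \<Rightarrow> tree) \<Rightarrow> (tree \<Rightarrow> nat) \<Rightarrow> bool" where
  "timed F T \<longleftrightarrow> (\<exists>P. \<forall>x. \<exists>t\<le>T x. computes_in P x (F x) t)"

text \<open>There is no overhead: \<open>T y\<close> already pays for the initial
  \<open>Call 0 Arg\<close>, whose place the outer call takes.\<close>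

lemma runs_shift:
  assumes P: "\<forall>x. \<exists>t\<le>T x. computes_in P x (F x) t" and y:
    "runs (Q @ map (shift (length Q)) P @ R) x e y t"
  shows "runs (Q @ map (shift (length Q)) P @ R) x (Call (length Q) e) (F y) (t + T y)"
proof -
  obtain u where u: "u \<le> T y" "evals P y (Call 0 Arg) (F y) u"
    using P unfolding computes_in_def by blast
  from u(2) obtain w t1 t2 where w: "evals P y Arg w t1" "0 < length P" "evals P w (P ! 0) (F y) t2"
    "u = t1 + t2 + 1" by (cases rule: evals.cases) auto
  from w(1) have "w = y" by cases auto
  with evals_shift[OF w(3), of Q R]
  have "evals (Q @ map (shift (length Q)) P @ R) y ((Q @ map (shift (length Q)) P @ R) ! length Q)
    (F y) t2"
    using w(2) by (simp add: nth_append)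
  then have "runs (Q @ map (shift (length Q)) P @ R) x (Call (length Q) e) (F y) (t + t2 + 1)"
    using y w(2) by (intro runs_Call[OF y]) (auto simp: runs_def)
  then show ?thesis using u(1) w(4) by (elim runs_mono) simp
qed

text \<open>As \<open>b\<close> is arbitrary, it may in particular be recursive, that is, contain \<open>Call 0\<close>.\<close>

lemma link:
  assumes "timed F T" "timed G U" "timed H W"
  obtains i j k R where
    "\<And>b x e y t. runs (b # R) x e y t \<Longrightarrow> runs (b # R) x (Call i e) (F y) (t + T y)"
    "\<And>b x e y t. runs (b # R) x e y t \<Longrightarrow> runs (b # R) x (Call j e) (G y) (t + U y)"
    "\<And>b x e y t. runs (b # R) x e y t \<Longrightarrow> runs (b # R) x (Call k e) (H y) (t + W y)"
proof -
  obtain P1 P2 P3 where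
    P1: "\<forall>x. \<exists>t\<le>T x. computes_in P1 x (F x) t" and
    P2: "\<forall>x. \<exists>t\<le>U x. computes_in P2 x (G x) t" and
    P3: "\<forall>x. \<exists>t\<le>W x. computes_in P3 x (H x) t"
    using assms unfolding timed_def by blast
  \<comment> \<open>Position 0 stays free for the body \<open>b\<close>; the three linked programs
    start at 1, \<open>j\<close> and \<open>k\<close>.\<close>
  define j where "j = 1 + length P1"
  define k where "k = j + length P2"
  define Q1 where "Q1 = map (shift 1) P1"
  define Q2 where "Q2 = map (shift j) P2"
  define Q3 where "Q3 = map (shift k) P3"
  define R where "R = Q1 @ Q2 @ Q3"
  have e1: "b # R = [b] @ map (shift (length [b])) P1 @ (Q2 @ Q3)"
    and e2: "b # R = (b # Q1) @ map (shift (length (b # Q1))) P2 @ Q3"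
    and e3: "b # R = (b # Q1 @ Q2) @ map (shift (length (b # Q1 @ Q2))) P3 @ []" for b
    by (simp_all add: R_def Q1_def Q2_def Q3_def j_def k_def)
  show thesis
  proof (rule that[of R 1 j k])
    fix b x e y t assume r: "runs (b # R) x e y t"
    show "runs (b # R) x (Call 1 e) (F y) (t + T y)"
      using runs_shift[OF P1 r[unfolded e1]] unfolding e1[symmetric] by simp
    show "runs (b # R) x (Call j e) (G y) (t + U y)"
      using runs_shift[OF P2 r[unfolded e2]] unfolding e2[symmetric] by (simp add: j_def Q1_def)
    show "runs (b # R) x (Call k e) (H y) (t + W y)"
      using runs_shift[OF P3 r[unfolded e3]] unfolding e3[symmetric]
      by (simp add: j_def k_def Q1_def Q2_def)
  qed
qed

text \<open>The additional 2 pays for \<open>Arg\<close> and for the starting call in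
  \<open>computes_in\<close>.\<close>

lemma timedI:
  assumes "\<And>x. runs (b # R) x b (F x) (T x)"
  shows "timed F (\<lambda>x. T x + 2)"
  unfolding timed_def computes_in_def
proof (rule exI[of _ "b # R"], rule allI)
  fix x
  have "runs (b # R) x (Call 0 Arg) (F x) (1 + T x + 1)"
    using runs_Call[OF runs_Arg, of 0 "b # R" x "F x" "T x"] assms by simp
  then show "\<exists>t\<le>T x + 2. evals (b # R) x (Call 0 Arg) (F x) t"
    by (simp add: runs_def)
qed

section \<open>Closure of timed functions under the elementary operations\<close>

lemma timed_mono: "timed F T \<Longrightarrow> (\<And>x. T x \<le> T' x) \<Longrightarrow> timed F T'"
  unfolding timed_def by (meson le_trans)

lemma timed_id: "timed (\<lambda>x. x) (\<lambda>_. 3)"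
  using timedI[of Arg "[]" "\<lambda>x. x" "\<lambda>_. 1"] runs_Arg by (simp add: numeral_3_eq_3)

lemma timed_Leaf: "timed (\<lambda>_. Leaf) (\<lambda>_. 3)"
  using timedI[of LeafE "[]" "\<lambda>x. Leaf" "\<lambda>_. 1"] runs_LeafE by (simp add: numeral_3_eq_3)

lemma timed_Node:
  assumes "timed F T" "timed G U" shows "timed (\<lambda>x. Node (F x) (G x)) (\<lambda>x. T x + U x + 5)"
proof -
  obtain i j k R where
    i: "\<And>b x e y t. runs (b # R) x e y t \<Longrightarrow> runs (b # R) x (Call i e) (F y) (t + T y)" and
    j: "\<And>b x e y t. runs (b # R) x e y t \<Longrightarrow> runs (b # R) x (Call j e) (G y) (t + U y)"
    using link[OF assms(1,2,2)] by metis
  show ?thesis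
    by (rule timed_mono[OF timedI[OF runs_NodeE[OF i[OF runs_Arg] j[OF runs_Arg]]]]) simp
qed

lemma timed_left: assumes "timed F T" shows "timed (\<lambda>x. left (F x)) (\<lambda>x. T x + 4)"
proof -
  obtain i R where
    i: "\<And>b x e y t. runs (b # R) x e y t \<Longrightarrow> runs (b # R) x (Call i e) (F y) (t + T y)"
    using link[OF assms(1,1,1)] by metis
  show ?thesis by (rule timed_mono[OF timedI[OF runs_LeftE[OF i[OF runs_Arg]]]]) simp
qed

lemma timed_right: assumes "timed F T" shows "timed (\<lambda>x. right (F x)) (\<lambda>x. T x + 4)"
proof -
  obtain i R where
    i: "\<And>b x e y t. runs (b # R) x e y t \<Longrightarrow> runs (b # R) x (Call i e) (F y) (t + T y)"
    using link[OF assms(1,1,1)] by metis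
  show ?thesis by (rule timed_mono[OF timedI[OF runs_RightE[OF i[OF runs_Arg]]]]) simp
qed

lemma timed_comp:
  assumes "timed F T" "timed G U" shows "timed (\<lambda>x. G (F x)) (\<lambda>x. T x + U (F x) + 3)"
proof -
  obtain i j k R where
    i: "\<And>b x e y t. runs (b # R) x e y t \<Longrightarrow> runs (b # R) x (Call i e) (F y) (t + T y)" and
    j: "\<And>b x e y t. runs (b # R) x e y t \<Longrightarrow> runs (b # R) x (Call j e) (G y) (t + U y)"
    using link[OF assms(1,2,2)] by metis
  show ?thesis by (rule timed_mono[OF timedI[OF j[OF i[OF runs_Arg]]]]) simp
qed

lemma timed_if:
  assumes "timed F T" "timed G U" "timed H W"
  shows "timed (\<lambda>x. if F x = Leaf then H x else G x) (\<lambda>x. T x + U x + W x + 6)"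
proof -
  obtain i j k R where
    i: "\<And>b x e y t. runs (b # R) x e y t \<Longrightarrow> runs (b # R) x (Call i e) (F y) (t + T y)" and
    j: "\<And>b x e y t. runs (b # R) x e y t \<Longrightarrow> runs (b # R) x (Call j e) (G y) (t + U y)" and
    k: "\<And>b x e y t. runs (b # R) x e y t \<Longrightarrow> runs (b # R) x (Call k e) (H y) (t + W y)"
    using link[OF assms] by metis
  define b where "b = IfE (Call i Arg) (Call j Arg) (Call k Arg)"
  have "runs (b # R) x b (if F x = Leaf then H x else G x) (1 + T x + (1 + U x + W x) + 1)" for x
    unfolding b_def
    using runs_mono[OF j[OF runs_Arg], where T' = "1 + U x + W x"]
      runs_mono[OF k[OF runs_Arg], where T' = "1 + U x + W x"]
    by (intro runs_IfE[OF i[OF runs_Arg]]) simp_all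
  from timed_mono[OF timedI[OF this]] show ?thesis by simp
qed

section \<open>Lists and folds as programs\<close>

fun list_of :: "tree \<Rightarrow> tree list" where
  "list_of Leaf = []"
| "list_of (Node h t) = h # list_of t"

lemma list_of_list_tree [simp]: "list_of (list_tree xs) = xs"
  by (induction xs) auto

lemma list_tree_list_of [simp]: "list_tree (list_of t) = t"
  by (induction t) auto

text \<open>Functions have a single parameter and no closures, so the environment \<open>e\<close>
  travels in the argument together with the list entry and the accumulator.\<close>

abbreviation (input) foldT :: "(tree \<Rightarrow> tree) \<Rightarrow> tree \<Rightarrow> tree list \<Rightarrow> tree \<Rightarrow> tree" where
  "foldT G e \<equiv> foldr (\<lambda>h a. G (Node e (Node h a)))"

text \<open>The cost of a step depends on the accumulator it meets, which is the fold over the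
  remaining suffix. The numbers 8 and 30 round up the cost of the loop body.\<close>

fun fold_time :: "(tree \<Rightarrow> tree) \<Rightarrow> (tree \<Rightarrow> nat) \<Rightarrow> tree \<Rightarrow> tree \<Rightarrow> tree list \<Rightarrow> nat" where
  "fold_time G U e z [] = 8"
| "fold_time G U e z (h # t) = 30 + U (Node e (Node h (foldT G e t z))) + fold_time G U e z t"

lemma timed_fold:
  assumes "timed G U"
  shows "timed (\<lambda>x. foldT G (left (left x)) (list_of (right x)) (right (left x)))
    (\<lambda>x. fold_time G U (left (left x)) (right (left x)) (list_of (right x)) + 2)"
proof -
  obtain i R where
    i: "\<And>b x e y t. runs (b # R) x e y t \<Longrightarrow> runs (b # R) x (Call i e) (G y) (t + U y)"
    using link[OF assms(1,1,1)] by metis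
  \<comment> \<open>The argument has the layout \<open>Node (Node e z) l\<close>; the recursive
    \<open>Call 0\<close> keeps the left part and passes the tail of \<open>l\<close>.\<close>
  define b where "b = IfE (RightE Arg)
    (Call i (NodeE (LeftE (LeftE Arg)) (NodeE (LeftE (RightE Arg))
       (Call 0 (NodeE (LeftE Arg) (RightE (RightE Arg))))))) (RightE (LeftE Arg))"
  have main: "runs (b # R) x b (foldT G (left (left x)) l (right (left x)))
    (fold_time G U (left (left x)) (right (left x)) l)" if "list_of (right x) = l" for x l
    using that
  proof (induction l arbitrary: x)
    case Nil
    then have "right x = Leaf" by (cases "right x") auto
    then show ?case
      unfolding b_def foldr.simps fold_time.simps id_apply
      apply -
      apply (rule runs_mono)
       apply (rule runs_IfE)
         apply (rule runs_RightE, rule runs_Arg)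
        apply simp
       apply (rule runs_RightE, rule runs_LeftE, rule runs_Arg)
      apply simp
      done
  next
    case (Cons h l)
    then obtain t where t: "right x = Node h t" "list_of t = l" by (cases "right x") auto
    let ?x = "Node (left x) (right (right x))"
    have "runs (b # R) ?x b (foldT G (left (left x)) l (right (left x)))
      (fold_time G U (left (left x)) (right (left x)) l)"
      using Cons.IH[of ?x] t by simp
    then have c: "runs (b # R) x (Call 0 (NodeE (LeftE Arg) (RightE (RightE Arg))))
      (foldT G (left (left x)) l (right (left x))) ((1 + 1 + (1 + 1 + 1) + 1) +
      (fold_time G U (left (left x)) (right (left x)) l) + 1)"
      by (intro runs_Call[where w = ?x] runs_NodeE runs_LeftE runs_RightE runs_Arg) auto
    have "right x \<noteq> Leaf" using t by simp
    then show ?case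
      apply (subst (2) b_def)
      apply (rule runs_mono)
       apply (rule runs_IfE)
         apply (rule runs_RightE, rule runs_Arg)
      apply simp
        apply (rule i)
        apply (rule runs_NodeE)
         apply (rule runs_LeftE, rule runs_LeftE, rule runs_Arg)
        apply (rule runs_NodeE)
        apply (subgoal_tac "h = left (right x)")
          apply (simp only:)
          apply (rule runs_LeftE, rule runs_RightE, rule runs_Arg)
      using t apply simp
        apply (rule c)
       apply simp
      apply simp
      done
  qed
  show ?thesis by (rule timedI[OF main]) simp
qed

section \<open>Polynomial time\<close>

text \<open>One constant is both offset and exponent, so two bounds are merged by enlarging
  it.\<close>

definition pb :: "(tree \<Rightarrow> nat) \<Rightarrow> (tree \<Rightarrow> nat) \<Rightarrow> bool" where
  "pb B T \<longleftrightarrow> (\<exists>c. \<forall>x. T x \<le> (tree_size x + B x + c) ^ c)"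

lemma tree_size_pos: "0 < tree_size t"
  by (cases t) auto

lemma pbI: "(\<And>x. T x \<le> (tree_size x + B x + c) ^ c) \<Longrightarrow> pb B T"
  unfolding pb_def by blast

lemma pb_mono: "pb B T \<Longrightarrow> (\<And>x. U x \<le> T x) \<Longrightarrow> pb B U"
  unfolding pb_def by (meson le_trans)

lemma pb_size: "pb B tree_size"
  by (rule pbI[of _ _ 1]) simp

lemma pb_param: "pb B B"
  by (rule pbI[of _ _ 1]) simp

lemma pb_const: "pb B (\<lambda>_. k)"
proof (rule pbI[of _ _ "Suc k"])
  fix x
  have "k \<le> (tree_size x + B x + Suc k) ^ 1" by simp
  also have "\<dots> \<le> (tree_size x + B x + Suc k) ^ Suc k" by (rule power_increasing) auto
  finally show "k \<le> (tree_size x + B x + Suc k) ^ Suc k" .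
qed

lemma pb_mult: assumes "pb B T" "pb B U" shows "pb B (\<lambda>x. T x * U x)"
proof -
  obtain c d where c: "\<And>x. T x \<le> (tree_size x + B x + c) ^ c" and d:
    "\<And>x. U x \<le> (tree_size x + B x + d) ^ d"
    using assms unfolding pb_def by blast
  show ?thesis
  proof (rule pbI)
    fix x
    let ?m = "tree_size x + B x + (c + d)"
    have "T x * U x \<le> ?m ^ c * ?m ^ d"
      by (intro mult_le_mono order_trans[OF c] order_trans[OF d] power_mono) auto
    then show "T x * U x \<le> ?m ^ (c + d)" by (simp add: power_add)
  qed
qed

lemma pb_Suc: assumes "pb B T" shows "pb B (\<lambda>x. Suc (T x))"
proof -
  obtain c where c: "\<And>x. T x \<le> (tree_size x + B x + c) ^ c"
    using assms unfolding pb_def by blast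
  show ?thesis
  proof (rule pbI)
    fix x
    \<comment> \<open>The offset makes \<open>?m\<close> at least 2, so that a factor 2 is absorbed
      by one more power.\<close>
    let ?m = "tree_size x + B x + (c + 2)"
    have "T x \<le> ?m ^ c" by (intro order_trans[OF c] power_mono) auto
    moreover have "1 \<le> ?m ^ c" by simp
    ultimately have "Suc (T x) \<le> 2 * ?m ^ c" by linarith
    also have "\<dots> \<le> ?m ^ Suc c" by simp
    also have "\<dots> \<le> ?m ^ (c + 2)" by (rule power_increasing) auto
    finally show "Suc (T x) \<le> ?m ^ (c + 2)" .
  qed
qed

text \<open>Sums reduce to products by \<open>T + U \<le> Suc T * Suc U\<close>.\<close>

lemma pb_add: assumes "pb B T" "pb B U" shows "pb B (\<lambda>x. T x + U x)"
  by (rule pb_mono[OF pb_mult[OF pb_Suc[OF assms(1)] pb_Suc[OF assms(2)]]]) simp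

lemma pb_power: assumes "pb B T" shows "pb B (\<lambda>x. T x ^ k)"
proof (induction k)
  case 0 show ?case using pb_const by simp
next
  case (Suc k) then show ?case using pb_mult[OF assms] by simp
qed

text \<open>The outer bound has to be polynomial in the size alone, because \<open>B (F x)\<close>
  is unrelated to \<open>B x\<close>.\<close>

lemma pb_comp:
  assumes "pb (\<lambda>_. 0) T" "pb B (\<lambda>x. tree_size (F x))" shows "pb B (\<lambda>x. T (F x))"
proof -
  obtain c where c: "\<And>x. T x \<le> (tree_size x + c) ^ c"
    using assms(1) unfolding pb_def by auto
  show ?thesis
    by (rule pb_mono[OF pb_power[OF pb_add[OF assms(2) pb_const]] c])
qed

text \<open>
  \<open>B\<close> bounds intermediate results that are not of polynomial size.  The size of the output has
  to be controlled separately from the time, since shared subtrees count repeatedly in it.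
\<close>

definition FPB :: "(tree \<Rightarrow> nat) \<Rightarrow> (tree \<Rightarrow> tree) \<Rightarrow> bool" where
  "FPB B F \<longleftrightarrow> (\<exists>T. timed F T \<and> pb B T) \<and> pb B (\<lambda>x. tree_size (F x))"

abbreviation FP :: "(tree \<Rightarrow> tree) \<Rightarrow> bool" where
  "FP \<equiv> FPB (\<lambda>_. 0)"

lemma FPBE:
  assumes "FPB B F" obtains T where "timed F T" "pb B T" "pb B (\<lambda>x. tree_size (F x))"
  using assms unfolding FPB_def by blast

lemma FPBI: "timed F T \<Longrightarrow> pb B T \<Longrightarrow> pb B (\<lambda>x. tree_size (F x)) \<Longrightarrow> FPB B F"
  unfolding FPB_def by blast

lemma FPB_size: "FPB B F \<Longrightarrow> pb B (\<lambda>x. tree_size (F x))"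
  unfolding FPB_def by blast

text \<open>The collected rules follow the shape of a HOL term: \<open>intro fp\<close> derives from
  a definition both a program and its bounds.\<close>

named_theorems fp

lemma FPB_id [fp]: "FPB B (\<lambda>x. x)"
  by (rule FPBI[OF timed_id pb_const pb_size])

lemma FPB_Leaf [fp]: "FPB B (\<lambda>x. Leaf)"
  by (rule FPBI[OF timed_Leaf pb_const pb_const])

lemma FPB_Node [fp]: assumes "FPB B F" "FPB B G" shows "FPB B (\<lambda>x. Node (F x) (G x))"
proof -
  obtain T where T: "timed F T" "pb B T" "pb B (\<lambda>x. tree_size (F x))" using assms(1) by (rule FPBE)
  obtain U where U: "timed G U" "pb B U" "pb B (\<lambda>x. tree_size (G x))" using assms(2) by (rule FPBE)
  show ?thesis
    by (rule FPBI[OF timed_Node[OF T(1) U(1)]])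
      (auto intro!: pb_add pb_Suc pb_const T U)
qed

lemma tree_size_left: "tree_size (left t) \<le> tree_size t"
  by (cases t) auto

lemma tree_size_right: "tree_size (right t) \<le> tree_size t"
  by (cases t) auto

lemma FPB_left [fp]: assumes "FPB B F" shows "FPB B (\<lambda>x. left (F x))"
proof -
  obtain T where T: "timed F T" "pb B T" "pb B (\<lambda>x. tree_size (F x))" using assms(1) by (rule FPBE)
  show ?thesis
    by (rule FPBI[OF timed_left[OF T(1)] pb_add[OF T(2) pb_const] pb_mono[OF T(3) tree_size_left]])
qed

lemma FPB_right [fp]: assumes "FPB B F" shows "FPB B (\<lambda>x. right (F x))"
proof -
  obtain T where T: "timed F T" "pb B T" "pb B (\<lambda>x. tree_size (F x))" using assms(1) by (rule FPBE)
  show ?thesis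
    by (rule FPBI[OF timed_right[OF T(1)] pb_add[OF T(2) pb_const] pb_mono[OF T(3) tree_size_right]])
qed

lemma FPB_comp: assumes "FP G" "FPB B F" shows "FPB B (\<lambda>x. G (F x))"
proof -
  obtain T where T: "timed F T" "pb B T" "pb B (\<lambda>x. tree_size (F x))" using assms(2) by (rule FPBE)
  obtain U where U: "timed G U" "pb (\<lambda>_. 0) U" "pb (\<lambda>_. 0) (\<lambda>x. tree_size (G x))"
    using assms(1) by (rule FPBE)
  show ?thesis
    by (rule FPBI[OF timed_comp[OF T(1) U(1)]])
      (intro pb_add pb_const T pb_comp[OF U(2) T(3)] pb_comp[OF U(3) T(3)])+
qed

text \<open>This separates the body of a function from its arguments: the body is analysed once, in
  polynomial time on a pair, and arguments whose bounds involve \<open>B\<close> are substituted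
  afterwards.\<close>

lemma FPB_app2:
  assumes "FP (\<lambda>y. g (left y) (right y))" "FPB B a" "FPB B b"
  shows "FPB B (\<lambda>x. g (a x) (b x))"
  using FPB_comp[OF assms(1) FPB_Node[OF assms(2,3)]] by simp

lemma FPB_app3:
  assumes "FP (\<lambda>y. g (left y) (left (right y)) (right (right y)))" "FPB B a" "FPB B b" "FPB B c"
  shows "FPB B (\<lambda>x. g (a x) (b x) (c x))"
  using FPB_comp[OF assms(1) FPB_Node[OF assms(2) FPB_Node[OF assms(3,4)]]] by simp

lemma FPB_if [fp]:
  assumes "FPB B (\<lambda>x. bool_tree (P x))" "FPB B F" "FPB B G"
  shows "FPB B (\<lambda>x. if P x then F x else G x)"
proof -
  obtain V where V: "timed (\<lambda>x. bool_tree (P x)) V" "pb B V" using assms(1) by (rule FPBE)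
  obtain T where T: "timed F T" "pb B T" "pb B (\<lambda>x. tree_size (F x))" using assms(2) by (rule FPBE)
  obtain U where U: "timed G U" "pb B U" "pb B (\<lambda>x. tree_size (G x))" using assms(3) by (rule FPBE)
  have "(if bool_tree (P x) = Leaf then G x else F x) = (if P x then F x else G x)" for x
    by (simp add: bool_tree_def)
  with timed_if[OF V(1) T(1) U(1)]
  have "timed (\<lambda>x. if P x then F x else G x) (\<lambda>x. V x + T x + U x + 6)" by simp
  then show ?thesis
  proof (rule FPBI)
    show "pb B (\<lambda>x. V x + T x + U x + 6)" by (intro pb_add pb_const V T U)
    show "pb B (\<lambda>x. tree_size (if P x then F x else G x))"
      by (rule pb_mono[OF pb_add[OF T(3) U(3)]]) simp
  qed
qed

lemma FPB_True [fp]: "FPB B (\<lambda>x. bool_tree True)"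
  and FPB_False [fp]: "FPB B (\<lambda>x. bool_tree False)"
  unfolding bool_tree_def by (simp_all add: FPB_Node FPB_Leaf)

lemma FPB_not [fp]: "FPB B (\<lambda>x. bool_tree (P x)) \<Longrightarrow> FPB B (\<lambda>x. bool_tree (\<not> P x))"
proof -
  assume *: "FPB B (\<lambda>x. bool_tree (P x))"
  have "bool_tree (\<not> P x) = (if P x then bool_tree False else bool_tree True)" for x by simp
  then show ?thesis using FPB_if[OF * FPB_False FPB_True] by simp
qed

lemma FPB_conj [fp]:
  assumes "FPB B (\<lambda>x. bool_tree (P x))" "FPB B (\<lambda>x. bool_tree (Q x))"
  shows "FPB B (\<lambda>x. bool_tree (P x \<and> Q x))"
proof -
  have "bool_tree (P x \<and> Q x) = (if P x then bool_tree (Q x) else bool_tree False)" for x by simp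
  then show ?thesis using FPB_if[OF assms FPB_False] by simp
qed

lemma FPB_disj [fp]:
  assumes "FPB B (\<lambda>x. bool_tree (P x))" "FPB B (\<lambda>x. bool_tree (Q x))"
  shows "FPB B (\<lambda>x. bool_tree (P x \<or> Q x))"
proof -
  have "bool_tree (P x \<or> Q x) = (if P x then bool_tree True else bool_tree (Q x))" for x by simp
  then show ?thesis using FPB_if[OF assms(1) FPB_True assms(2)] by simp
qed

lemma FPB_iff [fp]:
  assumes "FPB B (\<lambda>x. bool_tree (P x))" "FPB B (\<lambda>x. bool_tree (Q x))"
  shows "FPB B (\<lambda>x. bool_tree (P x \<longleftrightarrow> Q x))"
proof -
  have "bool_tree (P x \<longleftrightarrow> Q x) = (if P x then bool_tree (Q x) else bool_tree (\<not> Q x))" for x by simp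
  then show ?thesis using FPB_if[OF assms FPB_not[OF assms(2)]] by simp
qed

text \<open>Comparison with \<open>Leaf\<close> is the only test of the language. Later definitions
  therefore state emptiness as a negated \<open>\<noteq> Leaf\<close>, to fit this rule.\<close>

lemma FPB_nonLeaf [fp]: assumes "FPB B F" shows "FPB B (\<lambda>x. bool_tree (F x \<noteq> Leaf))"
proof -
  obtain T where T: "timed F T" "pb B T" using assms(1) by (rule FPBE)
  have "timed (\<lambda>x. if F x = Leaf then Leaf else Node Leaf Leaf) (\<lambda>x. T x + (3 + 3 + 5) + 3 + 6)"
    by (intro timed_if timed_Node timed_Leaf T)
  moreover have "(if F x = Leaf then Leaf else Node Leaf Leaf) = bool_tree (F x \<noteq> Leaf)" for x
    by (simp add: bool_tree_def)
  ultimately have t: "timed (\<lambda>x. bool_tree (F x \<noteq> Leaf)) (\<lambda>x. T x + (3 + 3 + 5) + 3 + 6)" by simp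
  show ?thesis
  proof (rule FPBI[OF t])
    show "pb B (\<lambda>x. T x + (3 + 3 + 5) + 3 + 6)" by (intro pb_add pb_const T)
    show "pb B (\<lambda>x. tree_size (bool_tree (F x \<noteq> Leaf)))"
      by (rule pb_mono[OF pb_const[of _ 3]]) (simp add: bool_tree_def)
  qed
qed

lemma tree_size_list_tree: "tree_size (list_tree xs) = Suc (\<Sum>x\<leftarrow>xs. Suc (tree_size x))"
  by (induction xs) auto

lemma tree_size_list_of: "tree_size t = Suc (\<Sum>x\<leftarrow>list_of t. Suc (tree_size x))"
  using tree_size_list_tree[of "list_of t"] by simp

lemma length_list_of: "length (list_of t) \<le> tree_size t"
  by (induction t rule: list_of.induct) auto

lemma fold_time_le:
  assumes "\<And>h ys zs. l = zs @ h # ys \<Longrightarrow> U (Node e (Node h (foldT G e ys z))) \<le> V"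
  shows "fold_time G U e z l \<le> length l * (30 + V) + 8"
  using assms
proof (induction l)
  case (Cons h l)
  have "fold_time G U e z l \<le> length l * (30 + V) + 8"
    by (rule Cons.IH) (use Cons.prems[of "h # _"] in simp)
  moreover have "U (Node e (Node h (foldT G e l z))) \<le> V" using Cons.prems[of "[]"] by simp
  ultimately show ?case by simp
qed simp

text \<open>Iterating a polynomial-time step can produce exponentially large values. Hence
  \<open>le\<close> bounds all intermediate accumulators; as \<open>foldr\<close> works from the
  right, these are the folds over suffixes.\<close>

lemma FPB_foldT:
  assumes G: "FP G" and e: "FPB B e" and z: "FPB B z" and l: "FPB B l" and b: "pb B b"
    and le: "\<And>x zs ys. list_of (l x) = zs @ ys \<Longrightarrow> tree_size (foldT G (e x) ys (z x)) \<le> b x"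
  shows "FPB B (\<lambda>x. foldT G (e x) (list_of (l x)) (z x))"
proof -
  obtain U where U: "timed G U" "pb (\<lambda>_. 0) U" using G by (rule FPBE)
  then obtain c where c: "\<And>x. U x \<le> (tree_size x + c) ^ c" unfolding pb_def by auto
  let ?F = "\<lambda>x. Node (Node (e x) (z x)) (l x)"
  have "FPB B ?F" by (intro FPB_Node e z l)
  then obtain T where T: "timed ?F T" "pb B T" by (rule FPBE)
  let ?W = "\<lambda>x. length (list_of (l x)) * (30 + (2 + tree_size (e x) + tree_size (l x) + b x + c) ^
    c) + 8"
  have "fold_time G U (e x) (z x) (list_of (l x)) \<le> ?W x" for x
  proof (rule fold_time_le)
    fix h ys zs assume *: "list_of (l x) = zs @ h # ys"
    have "tree_size (foldT G (e x) ys (z x)) \<le> b x" using le[of x "zs @ [h]" ys] * by simp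
    moreover have "tree_size h \<le> tree_size (l x)" by (subst (2) tree_size_list_of) (simp add: *)
    ultimately show "U (Node (e x) (Node h (foldT G (e x) ys (z x))))
      \<le> (2 + tree_size (e x) + tree_size (l x) + b x + c) ^ c"
      by (intro order_trans[OF c] power_mono) simp_all
  qed
  then have 1: "timed (\<lambda>x. foldT G (e x) (list_of (l x)) (z x)) (\<lambda>x. T x + (?W x + 2) + 3)"
    by (intro timed_mono[OF timed_comp[OF T(1) timed_fold[OF U(1)], simplified]]) (simp add: add.commute)
  have "pb B (\<lambda>x. T x + (?W x + 2) + 3)"
    by (intro pb_add pb_const pb_mult pb_power T b FPB_size[OF e] FPB_size[OF l]
      pb_mono[OF FPB_size[OF l] length_list_of])
  moreover have "pb B (\<lambda>x. tree_size (foldT G (e x) (list_of (l x)) (z x)))"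
    by (rule pb_mono[OF b]) (use le[of _ "[]"] in simp)
  ultimately show ?thesis by (rule FPBI[OF 1])
qed

lemma FPB_foldr:
  assumes "FP (\<lambda>y. f (left y) (left (right y)) (right (right y)))" "FPB B l" "FPB B z" "pb B b"
    and "\<And>x zs ys. list_of (l x) = zs @ ys \<Longrightarrow> tree_size (foldr (f x) ys (z x)) \<le> b x"
  shows "FPB B (\<lambda>x. foldr (f x) (list_of (l x)) (z x))"
  using FPB_foldT[OF assms(1) FPB_id assms(3,2,4)] assms(5) by simp

section \<open>Quantifiers and list functions in polynomial time\<close>

lemma FPB_bex [fp]:
  assumes "FP (\<lambda>y. bool_tree (P (left y) (left (right y))))" "FPB B l"
  shows "FPB B (\<lambda>x. bool_tree (\<exists>v\<in>set (list_of (l x)). P x v))"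
proof -
  let ?f = "\<lambda>x h a. if P x h then bool_tree True else a"
  have eq: "foldr (?f x) ys Leaf = bool_tree (\<exists>v\<in>set ys. P x v)" for x ys
    by (induction ys) (simp_all, simp add: bool_tree_def)
  have "FPB B (\<lambda>x. foldr (?f x) (list_of (l x)) Leaf)"
    by (rule FPB_foldr[OF _ assms(2) FPB_Leaf pb_const[of _ 3]])
      (intro fp assms, simp add: eq bool_tree_def)
  then show ?thesis by (simp add: eq)
qed

lemma FPB_ball [fp]:
  assumes "FP (\<lambda>y. bool_tree (P (left y) (left (right y))))" "FPB B l"
  shows "FPB B (\<lambda>x. bool_tree (\<forall>v\<in>set (list_of (l x)). P x v))"
  using FPB_not[OF FPB_bex[OF FPB_not[OF assms(1)] assms(2)]] by simp

lemma sum_list_filter_le: "sum_list (map f (filter P xs)) \<le> (sum_list (map f xs) :: nat)"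
  by (induction xs) auto

lemma FPB_filter [fp]:
  assumes "FP (\<lambda>y. bool_tree (P (left y) (left (right y))))" "FPB B l"
  shows "FPB B (\<lambda>x. list_tree (filter (P x) (list_of (l x))))"
proof -
  let ?f = "\<lambda>x h a. if P x h then Node h a else a"
  have eq: "foldr (?f x) ys Leaf = list_tree (filter (P x) ys)" for x ys
    by (induction ys) auto
  have "FPB B (\<lambda>x. foldr (?f x) (list_of (l x)) Leaf)"
  proof (rule FPB_foldr[OF _ assms(2) FPB_Leaf FPB_size[OF assms(2)]])
    fix x zs ys assume "list_of (l x) = zs @ ys"
    then show "tree_size (foldr (?f x) ys Leaf) \<le> tree_size (l x)"
      unfolding eq tree_size_list_tree
      by (subst tree_size_list_of) (simp add: sum_list_filter_le trans_le_add2)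
  qed (intro fp assms)
  then show ?thesis by (simp add: eq)
qed

lemma FPB_append [fp]:
  assumes "FPB B a" "FPB B b"
  shows "FPB B (\<lambda>x. list_tree (list_of (a x) @ list_of (b x)))"
proof -
  let ?f = "\<lambda>x::tree. Node"
  have eq: "foldr (?f x) ys (b x) = list_tree (ys @ list_of (b x))" for x ys
    by (induction ys) auto
  have "FPB B (\<lambda>x. foldr (?f x) (list_of (a x)) (b x))"
  proof (rule FPB_foldr[OF _ assms pb_add[OF FPB_size[OF assms(1)] FPB_size[OF assms(2)]]])
    fix x zs ys assume "list_of (a x) = zs @ ys"
    then show "tree_size (foldr (?f x) ys (b x)) \<le> tree_size (a x) + tree_size (b x)"
      unfolding eq tree_size_list_tree
      by (subst (2 3) tree_size_list_of) simp
  qed (intro fp)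
  then show ?thesis by (simp add: eq)
qed

lemma FPB_map [fp]:
  assumes "FP (\<lambda>y. g (left y) (left (right y)))" "FPB B l"
  shows "FPB B (\<lambda>x. list_tree (map (g x) (list_of (l x))))"
proof -
  let ?f = "\<lambda>x h a. Node (g x h) a"
  have eq: "foldr (?f x) ys Leaf = list_tree (map (g x) ys)" for x ys
    by (induction ys) auto
  obtain c where c: "\<And>y. tree_size (g (left y) (left (right y))) \<le> (tree_size y + c) ^ c"
    using FPB_size[OF assms(1)] unfolding pb_def by auto
  \<comment> \<open>The 3 counts the two nodes and the leaf of \<open>Node x (Node h Leaf)\<close>,
    a pair to which the bound for \<open>g\<close> is applied below.\<close>
  let ?W = "\<lambda>x. (3 + tree_size x + tree_size (l x) + c) ^ c"
  have "FPB B (\<lambda>x. foldr (?f x) (list_of (l x)) Leaf)"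
  proof (rule FPB_foldr[OF _ assms(2) FPB_Leaf])
    show "pb B (\<lambda>x. 1 + tree_size (l x) * (1 + ?W x))"
      by (intro pb_add pb_const pb_mult pb_power pb_size FPB_size[OF assms(2)])
    fix x zs ys assume *: "list_of (l x) = zs @ ys"
    have "tree_size (g x h) \<le> ?W x" if "h \<in> set ys" for h
    proof -
      have "Suc (tree_size h) \<le> (\<Sum>x\<leftarrow>ys. Suc (tree_size x))"
        using that by (intro member_le_sum_list) auto
      then have "tree_size h \<le> tree_size (l x)" by (subst (2) tree_size_list_of) (simp add: *)
      then show ?thesis using c[of "Node x (Node h Leaf)"]
        by (simp, elim order_trans) (intro power_mono, simp_all)
    qed
    then have "(\<Sum>h\<leftarrow>ys. Suc (tree_size (g x h))) \<le> (\<Sum>h\<leftarrow>ys. 1 + ?W x)"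
      by (intro sum_list_mono) simp
    also have "\<dots> = length ys * (1 + ?W x)" by (simp add: sum_list_triv)
    also have "\<dots> \<le> tree_size (l x) * (1 + ?W x)"
      using length_list_of[of "l x"] by (intro mult_le_mono) (simp_all add: *)
    finally show "tree_size (foldr (?f x) ys Leaf) \<le> 1 + tree_size (l x) * (1 + ?W x)"
      unfolding eq tree_size_list_tree by (simp add: o_def)
  qed (intro fp assms)
  then show ?thesis by (simp add: eq)
qed

text \<open>Lists double as unary numbers with their length as value, so this one operation provides
  indexing, truncated subtraction and comparison.\<close>

definition drop_t :: "tree \<Rightarrow> tree \<Rightarrow> tree" where
  "drop_t u t = list_tree (drop (length (list_of u)) (list_of t))"

lemma right_list_tree: "right (list_tree xs) = list_tree (tl xs)"
  by (cases xs) auto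

lemma FPB_drop [fp]:
  assumes "FPB B u" "FPB B t" shows "FPB B (\<lambda>x. drop_t (u x) (t x))"
proof -
  let ?f = "\<lambda>(x::tree) (h::tree) a. right a"
  have eq: "foldr (?f x) ys t = list_tree (drop (length ys) (list_of t))" for x ys t
  proof (induction ys)
    case (Cons y ys)
    show ?case by (simp add: Cons right_list_tree tl_drop drop_Suc)
  qed simp
  have "FPB B (\<lambda>x. foldr (?f x) (list_of (u x)) (t x))"
  proof (rule FPB_foldr[OF _ assms FPB_size[OF assms(2)]])
    fix x and ys :: "tree list"
    show "tree_size (foldr (?f x) ys (t x)) \<le> tree_size (t x)"
      by (induction ys) (auto intro: order_trans[OF tree_size_right])
  qed (intro fp)
  then show ?thesis by (simp add: eq drop_t_def)
qed

section \<open>Computable functions and fixed-parameter tractability\<close>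

definition comput :: "(tree \<Rightarrow> tree) \<Rightarrow> bool" where
  "comput F \<longleftrightarrow> (\<exists>T. timed F T)"

lemma comput_id: "comput (\<lambda>x. x)"
  and comput_Leaf: "comput (\<lambda>x. Leaf)"
  and comput_Node: "comput F \<Longrightarrow> comput G \<Longrightarrow> comput (\<lambda>x. Node (F x) (G x))"
  and comput_left: "comput F \<Longrightarrow> comput (\<lambda>x. left (F x))"
  and comput_right: "comput F \<Longrightarrow> comput (\<lambda>x. right (F x))"
  and comput_comp: "comput G \<Longrightarrow> comput F \<Longrightarrow> comput (\<lambda>x. G (F x))"
  unfolding comput_def
  using timed_id timed_Leaf timed_Node timed_left timed_right timed_comp by blast+

lemma comput_foldr:
  assumes "comput (\<lambda>y. f (left y) (left (right y)) (right (right y)))" "comput l" "comput z"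
  shows "comput (\<lambda>x. foldr (f x) (list_of (l x)) (z x))"
proof -
  let ?G = "\<lambda>y. f (left y) (left (right y)) (right (right y))"
  have "comput (\<lambda>x. foldT ?G (left (left x)) (list_of (right x)) (right (left x)))"
    using assms(1) timed_fold unfolding comput_def by blast
  from comput_comp[OF this comput_Node[OF comput_Node[OF comput_id assms(3)] assms(2)]]
  show ?thesis by simp
qed

text \<open>\<open>F\<close> is a total function on trees, so the closure rules apply to it, while
  only its values on numerals are prescribed.\<close>

definition computable_on_unary :: "(nat \<Rightarrow> nat) \<Rightarrow> bool" where
  "computable_on_unary f \<longleftrightarrow> (\<exists>F. comput F \<and> (\<forall>k. F (unary_tree k) = unary_tree (f k)))"

lemma computable_on_unary_imp: "computable_on_unary f \<Longrightarrow> computable_fun f"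
  unfolding computable_on_unary_def computable_fun_def comput_def timed_def by metis

lemma unary_tree_0 [simp]: "unary_tree 0 = Leaf"
  and unary_tree_Suc [simp]: "unary_tree (Suc k) = Node Leaf (unary_tree k)"
  by (simp_all add: unary_tree_def)

lemma list_of_unary [simp]: "list_of (unary_tree k) = replicate k Leaf"
  by (simp add: unary_tree_def)

lemma computable_id: "computable_on_unary (\<lambda>k. k)"
  unfolding computable_on_unary_def using comput_id by blast

lemma computable_const: "computable_on_unary (\<lambda>k. c)"
proof -
  have "comput (\<lambda>_. unary_tree c)"
    by (induction c) (auto intro: comput_Leaf comput_Node)
  then show ?thesis unfolding computable_on_unary_def by blast
qed

text \<open>The iteration is a fold over the numeral of \<open>f k\<close>, whose entries are
  ignored and whose length is the number of rounds.\<close>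

lemma computable_recursion:
  assumes s: "comput (\<lambda>y. s (left y) (right y))" and z: "comput z" and f: "computable_on_unary f"
    and "\<And>k. z (unary_tree k) = unary_tree (r k 0)"
    and "\<And>k i. s (unary_tree k) (unary_tree (r k i)) = unary_tree (r k (Suc i))"
  shows "computable_on_unary (\<lambda>k. r k (f k))"
proof -
  obtain F where F: "comput F" "\<And>k. F (unary_tree k) = unary_tree (f k)"
    using f unfolding computable_on_unary_def by blast
  have "comput (\<lambda>y. s (left y) (right (right y)))"
    using comput_comp[OF s comput_Node[OF comput_left[OF comput_id] comput_right[OF
      comput_right[OF comput_id]]]]
    by simp
  then have c: "comput (\<lambda>x. foldr (\<lambda>_. s x) (list_of (F x)) (z x))"
    by (rule comput_foldr[OF _ F(1) z])
  have "foldr (\<lambda>_. s (unary_tree k)) (replicate i Leaf) (z (unary_tree k)) = unary_tree (r k i)" for k i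
    by (induction i) (simp_all add: assms(4,5))
  then show ?thesis unfolding computable_on_unary_def using c F(2) by (intro exI[of _
    "\<lambda>x. foldr (\<lambda>_. s x) (list_of (F x)) (z x)"]) simp
qed

section \<open>Unary arithmetic for the parameter bound\<close>

definition add_t :: "tree \<Rightarrow> tree \<Rightarrow> tree" where
  "add_t u v = foldr (\<lambda>_. Node Leaf) (list_of u) v"

definition mult_t :: "tree \<Rightarrow> tree \<Rightarrow> tree" where
  "mult_t u v = foldr (\<lambda>_. add_t u) (list_of v) Leaf"

lemma add_t_unary: "add_t (unary_tree m) (unary_tree n) = unary_tree (m + n)"
  unfolding add_t_def by (induction m) auto

lemma mult_t_unary: "mult_t (unary_tree m) (unary_tree n) = unary_tree (m * n)"
  unfolding mult_t_def by (induction n) (auto simp: add_t_unary)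

lemma comput_add: "comput F \<Longrightarrow> comput G \<Longrightarrow> comput (\<lambda>x. add_t (F x) (G x))"
  unfolding add_t_def
  by (rule comput_foldr) (intro comput_Node comput_Leaf comput_right comput_id, assumption+)

lemma comput_mult:
  assumes "comput F" "comput G" shows "comput (\<lambda>x. mult_t (F x) (G x))"
  unfolding mult_t_def
proof (rule comput_foldr[OF _ assms(2) comput_Leaf])
  show "comput (\<lambda>y. add_t (F (left y)) (right (right y)))"
    by (intro comput_add comput_comp[OF assms(1) comput_left] comput_right comput_id)
qed

lemma computable_add:
  assumes "computable_on_unary f" "computable_on_unary g" shows "computable_on_unary (\<lambda>k. f k + g k)"
proof -
  obtain F G where F: "comput F" "\<And>k. F (unary_tree k) = unary_tree (f k)"
    and G: "comput G" "\<And>k. G (unary_tree k) = unary_tree (g k)"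
    using assms unfolding computable_on_unary_def by blast
  show ?thesis unfolding computable_on_unary_def
    by (rule exI[of _ "\<lambda>x. add_t (F x) (G x)"]) (simp add: comput_add F G add_t_unary)
qed

lemma computable_mult:
  assumes "computable_on_unary f" "computable_on_unary g" shows "computable_on_unary (\<lambda>k. f k * g k)"
proof -
  obtain F G where F: "comput F" "\<And>k. F (unary_tree k) = unary_tree (f k)"
    and G: "comput G" "\<And>k. G (unary_tree k) = unary_tree (g k)"
    using assms unfolding computable_on_unary_def by blast
  show ?thesis unfolding computable_on_unary_def
    by (rule exI[of _ "\<lambda>x. mult_t (F x) (G x)"]) (simp add: comput_mult F G mult_t_unary)
qed

lemma computable_power:
  assumes "computable_on_unary f" "computable_on_unary g" shows "computable_on_unary (\<lambda>k. f k ^ g k)"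
proof -
  obtain F where F: "comput F" "\<And>k. F (unary_tree k) = unary_tree (f k)"
    using assms(1) unfolding computable_on_unary_def by blast
  have "comput (\<lambda>y. mult_t (F (left y)) (right y))"
    by (intro comput_mult comput_right comput_id comput_comp[OF F(1) comput_left])
  moreover have "comput (\<lambda>_. Node Leaf Leaf)" by (intro comput_Node comput_Leaf)
  ultimately show ?thesis
    using computable_recursion[OF _ _ assms(2), of "\<lambda>x. mult_t (F x)" "\<lambda>_. Node Leaf Leaf"
      "\<lambda>k i. f k ^ i"]
    by (simp add: F(2) mult_t_unary)
qed

text \<open>Writing \<open>s \<ge> 1\<close> for the input size, each of \<open>s\<close>,
  \<open>B\<close> and \<open>c\<close> is at most its coefficient 1, \<open>g\<close> or
  \<open>c\<close> times \<open>s ^ (d + 1)\<close>. Raising the sum to the power \<open>c\<close>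
  separates the parameter from the size.\<close>

theorem FPB_fpt:
  assumes "FPB B F" "computable_on_unary g"
    and yes: "\<And>x. x \<in> inst \<Longrightarrow> F (enc x) = bool_tree (yes x)"
    and B: "\<And>x. x \<in> inst \<Longrightarrow> B (enc x) \<le> g (\<kappa> x) * tree_size (enc x) ^ d"
  shows "fpt enc inst yes \<kappa>"
proof -
  obtain T where T: "timed F T" "pb B T" using assms(1) by (rule FPBE)
  obtain P where P: "\<And>x. \<exists>t\<le>T x. computes_in P x (F x) t" using T(1) unfolding timed_def by blast
  obtain c where c: "\<And>x. T x \<le> (tree_size x + B x + c) ^ c" using T(2) unfolding pb_def by blast
  let ?f = "\<lambda>k. (1 + g k + c) ^ c"
  show ?thesis unfolding fpt_def
  proof (rule exI[of _ P], rule exI[of _ ?f], rule exI[of _ "(d + 1) * c"], intro conjI ballI)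
    show "computable_fun ?f"
      by (intro computable_on_unary_imp computable_power computable_add computable_const assms)
    fix x assume x: "x \<in> inst"
    let ?s = "tree_size (enc x)"
    obtain t where t: "t \<le> T (enc x)" "computes_in P (enc x) (F (enc x)) t" using P by blast
    have s: "1 \<le> ?s" using tree_size_pos[of "enc x"] by simp
    have "?s ^ 1 \<le> ?s ^ (d + 1)" by (rule power_increasing) (use s in simp_all)
    moreover have "?s ^ d \<le> ?s ^ (d + 1)" by (rule power_increasing) (use s in simp_all)
    then have "B (enc x) \<le> g (\<kappa> x) * ?s ^ (d + 1)" using B[OF x] by (meson le_trans mult_le_mono2)
    moreover have "c \<le> c * ?s ^ (d + 1)" using s by simp
    ultimately have "?s + B (enc x) + c \<le> (1 + g (\<kappa> x) + c) * ?s ^ (d + 1)"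
      by (simp only: distrib_right power_one_right mult_1)
    then have "(?s + B (enc x) + c) ^ c \<le> ((1 + g (\<kappa> x) + c) * ?s ^ (d + 1)) ^ c"
      by (rule power_mono) simp
    also have "\<dots> = ?f (\<kappa> x) * ?s ^ ((d + 1) * c)" by (simp only: power_mult_distrib power_mult)
    finally have "t \<le> ?f (\<kappa> x) * ?s ^ ((d + 1) * c)" using t(1) c[of "enc x"] by linarith
    then show "\<exists>t. computes_in P (enc x) (bool_tree (yes x)) t \<and> t \<le> ?f (\<kappa> x) * ?s ^ ((d + 1) * c)"
      using t(2) yes[OF x] by auto
  qed
qed

section \<open>The program\<close>

text \<open>Vertices are represented by the unary indices of the rows of the adjacency matrix \<open>M\<close>.\<close>

definition len_t :: "tree \<Rightarrow> tree" where
  "len_t t = list_tree (map (\<lambda>_. Leaf) (list_of t))"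

text \<open>The length of the accumulator is the next free index, so the vertices appear in
  decreasing order, down to 0.\<close>

definition verts_t :: "tree \<Rightarrow> tree" where
  "verts_t M = foldr (\<lambda>_ a. Node (len_t a) a) (list_of M) Leaf"

definition entry :: "tree \<Rightarrow> tree \<Rightarrow> tree \<Rightarrow> bool" where
  "entry M u v \<longleftrightarrow> left (drop_t v (left (drop_t u M))) \<noteq> Leaf"

abbreviation vertices :: "tree \<Rightarrow> tree list" where
  "vertices M \<equiv> list_of (verts_t M)"

definition app_t :: "tree \<Rightarrow> tree \<Rightarrow> tree" where
  "app_t s t = list_tree (list_of s @ list_of t)"

definition twin_t :: "tree \<Rightarrow> tree \<Rightarrow> tree \<Rightarrow> bool" where
  "twin_t M = twin (entry M) (vertices M)"

definition indep_t :: "tree \<Rightarrow> tree \<Rightarrow> bool" where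
  "indep_t M S = indep (entry M) (set (list_of S))"

definition reps_t :: "tree \<Rightarrow> tree" where
  "reps_t M = foldr (\<lambda>v R. if \<exists>u\<in>set (list_of R). twin_t M u v then R else Node v R) (vertices M) Leaf"

definition class_t :: "tree \<Rightarrow> tree \<Rightarrow> tree" where
  "class_t M v = list_tree (filter (twin_t M v) (vertices M))"

definition indeps_t :: "tree \<Rightarrow> tree \<Rightarrow> tree" where
  "indeps_t M L = list_tree (filter (indep_t M) (list_of L))"

definition extend_t :: "tree \<Rightarrow> tree \<Rightarrow> tree \<Rightarrow> tree" where
  "extend_t M v L = app_t L (app_t
     (indeps_t M (list_tree (map (Node v) (list_of L))))
     (indeps_t M (list_tree (map (app_t (class_t M v)) (list_of L)))))"

definition cands_t :: "tree \<Rightarrow> tree list \<Rightarrow> tree" where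
  "cands_t M rs = foldr (extend_t M) rs (Node Leaf Leaf)"

text \<open>A substitute for equality, which the language cannot test directly; on unary numerals
  the two agree.\<close>

definition same_length :: "tree \<Rightarrow> tree \<Rightarrow> bool" where
  "same_length u v \<longleftrightarrow> \<not> drop_t u v \<noteq> Leaf \<and> \<not> drop_t v u \<noteq> Leaf"

definition absorbs_t :: "tree \<Rightarrow> tree \<Rightarrow> bool" where
  "absorbs_t M S \<longleftrightarrow> (\<forall>v\<in>set (vertices M). \<exists>w\<in>set (list_of S).
     same_length v w \<or> entry M v w \<or> (\<exists>z\<in>set (vertices M). entry M v z \<and> entry M z w))"

definition double_t :: "tree \<Rightarrow> tree \<Rightarrow> tree" where
  "double_t b a = (if b \<noteq> Leaf then Node Leaf (app_t a a) else app_t a a)"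

text \<open>
  Conversion of the binary digits \<open>ds\<close> to unary, cut off at the length of \<open>S\<close> after every
  digit, as the number itself may be exponential in the length of \<open>ds\<close>.
\<close>

definition cap_t :: "tree \<Rightarrow> tree \<Rightarrow> tree" where
  "cap_t S ds = foldr (\<lambda>b a. drop_t (drop_t (double_t b a) S) S) (list_of ds) Leaf"

definition small_t :: "tree \<Rightarrow> tree \<Rightarrow> bool" where
  "small_t q S \<longleftrightarrow> \<not> left q \<noteq> Leaf \<and> \<not> drop_t (cap_t S (right q)) S \<noteq> Leaf"

definition qk_t :: "tree \<Rightarrow> tree" where
  "qk_t x = bool_tree (\<exists>S\<in>set (list_of (cands_t (left x) (list_of (reps_t (left x))))).
     indep_t (left x) S \<and> absorbs_t (left x) S \<and> small_t (right x) S)"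

section \<open>Time bounds for the pieces of the program\<close>

lemma FPB_app_t [fp]: "FPB B a \<Longrightarrow> FPB B b \<Longrightarrow> FPB B (\<lambda>x. app_t (a x) (b x))"
  unfolding app_t_def by (rule FPB_append)

lemma FPB_len_t [fp]: "FPB B a \<Longrightarrow> FPB B (\<lambda>x. len_t (a x))"
  unfolding len_t_def by (intro fp)

lemma tree_size_unary [simp]: "tree_size (unary_tree k) = 2 * k + 1"
  by (induction k) auto

lemma len_t_eq: "len_t t = unary_tree (length (list_of t))"
  by (simp add: len_t_def unary_tree_def map_replicate_const)

lemma verts_aux: "foldr (\<lambda>_ a. Node (len_t a) a) ys Leaf = list_tree (rev (map unary_tree
  [0..<length ys]))"
  by (induction ys) (simp_all add: len_t_eq)

lemma verts_eq: "vertices M = rev (map unary_tree [0..<length (list_of M)])"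
  by (simp add: verts_t_def verts_aux)

lemma sum_list_le: "(\<And>x. x \<in> set xs \<Longrightarrow> f x \<le> (b::nat)) \<Longrightarrow> (\<Sum>x\<leftarrow>xs. f x) \<le> length xs * b"
  by (induction xs) (auto intro: add_mono)

lemma FPB_verts_t [fp]: assumes "FPB B M" shows "FPB B (\<lambda>x. verts_t (M x))"
  unfolding verts_t_def
proof (rule FPB_foldr[OF _ assms FPB_Leaf])
  let ?s = "\<lambda>x. tree_size (M x)"
  show "pb B (\<lambda>x. 1 + ?s x * (2 * ?s x + 2))"
    by (intro pb_add pb_mult pb_const FPB_size[OF assms])
  fix x zs ys assume *: "list_of (M x) = zs @ ys"
  have l: "length ys \<le> ?s x" using length_list_of[of "M x"] * by simp
  have "(\<Sum>t\<leftarrow>rev (map unary_tree [0..<length ys]). Suc (tree_size t)) \<le> length ys * (2 * length ys + 2)"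
    by (rule order_trans[OF sum_list_le[where b = "2 * length ys + 2"]]) auto
  also have "\<dots> \<le> ?s x * (2 * ?s x + 2)" using l by (intro mult_le_mono) auto
  finally show "tree_size (foldr (\<lambda>_ a. Node (len_t a) a) ys Leaf) \<le> 1 + ?s x * (2 * ?s x + 2)"
    unfolding verts_aux tree_size_list_tree by simp
qed (intro fp)

lemma FPB_entry [fp]:
  "FPB B M \<Longrightarrow> FPB B u \<Longrightarrow> FPB B v \<Longrightarrow> FPB B (\<lambda>x. bool_tree (entry (M x) (u x) (v x)))"
  unfolding entry_def by (intro fp)

lemma FPB_twin_t [fp]:
  assumes "FPB B M" "FPB B u" "FPB B v" shows "FPB B (\<lambda>x. bool_tree (twin_t (M x) (u x) (v x)))"
  by (rule FPB_app3[OF _ assms]) (unfold twin_t_def twin_def, intro fp)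

lemma FPB_indep_t [fp]:
  assumes "FPB B M" "FPB B S" shows "FPB B (\<lambda>x. bool_tree (indep_t (M x) (S x)))"
  by (rule FPB_app2[OF _ assms]) (unfold indep_t_def indep_def, intro fp)

lemma FPB_class_t [fp]:
  assumes "FPB B M" "FPB B v" shows "FPB B (\<lambda>x. class_t (M x) (v x))"
  by (rule FPB_app2[OF _ assms]) (unfold class_t_def, intro fp)

lemma FPB_indeps_t [fp]:
  assumes "FPB B M" "FPB B L" shows "FPB B (\<lambda>x. indeps_t (M x) (L x))"
  by (rule FPB_app2[OF _ assms]) (unfold indeps_t_def, intro fp)

lemma FPB_extend_t [fp]:
  assumes "FPB B M" "FPB B v" "FPB B L" shows "FPB B (\<lambda>x. extend_t (M x) (v x) (L x))"
  by (rule FPB_app3[OF _ assms]) (unfold extend_t_def, intro fp)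

lemma FPB_same_length [fp]:
  assumes "FPB B u" "FPB B v" shows "FPB B (\<lambda>x. bool_tree (same_length (u x) (v x)))"
  unfolding same_length_def by (intro fp assms)

lemma FPB_absorbs_t [fp]:
  assumes "FPB B M" "FPB B S" shows "FPB B (\<lambda>x. bool_tree (absorbs_t (M x) (S x)))"
  by (rule FPB_app2[OF _ assms]) (unfold absorbs_t_def, intro fp)

lemma FPB_double_t [fp]:
  assumes "FPB B b" "FPB B a" shows "FPB B (\<lambda>x. double_t (b x) (a x))"
  unfolding double_t_def by (intro fp assms)

lemma list_of_drop_t [simp]: "list_of (drop_t u t) = drop (length (list_of u)) (list_of t)"
  by (simp add: drop_t_def)

lemma list_of_app_t [simp]: "list_of (app_t s t) = list_of s @ list_of t"
  by (simp add: app_t_def)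

lemma tree_size_drop_t: "tree_size (drop_t u t) \<le> tree_size t"
proof -
  have "sum_list (drop n xs) \<le> (sum_list xs :: nat)" for n xs
    using sum_list_append[of "take n xs" "drop n xs"] by simp
  from this[of "length (list_of u)" "map (\<lambda>x. Suc (tree_size x)) (list_of t)"]
  show ?thesis by (subst (1 2) tree_size_list_of) (simp add: drop_map)
qed

text \<open>After every digit the outer \<open>drop_t\<close> returns a suffix of \<open>S\<close>
  itself, which keeps the accumulator no larger than \<open>S\<close>.\<close>

lemma FPB_cap_t [fp]:
  assumes "FPB B S" "FPB B ds" shows "FPB B (\<lambda>x. cap_t (S x) (ds x))"
proof (rule FPB_app2[OF _ assms])
  have S: "FP (\<lambda>x. left x)" and ds: "FP (\<lambda>x. right x)" by (intro fp)+
  show "FP (\<lambda>y. cap_t (left y) (right y))" unfolding cap_t_def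
  proof (rule FPB_foldr[OF _ ds FPB_Leaf FPB_size[OF S]])
    fix x and ys :: "tree list"
    show "tree_size (foldr (\<lambda>b a. drop_t (drop_t (double_t b a) (left x)) (left x)) ys Leaf) \<le>
      tree_size (left x)"
      using tree_size_pos[of "left x"] by (cases ys) (simp_all add: tree_size_drop_t Suc_le_eq)
  qed (intro fp)
qed

lemma FPB_small_t [fp]:
  assumes "FPB B q" "FPB B S" shows "FPB B (\<lambda>x. bool_tree (small_t (q x) (S x)))"
  unfolding small_t_def by (intro fp assms)

lemma reps_t_aux:
  "foldr (\<lambda>v R. if \<exists>u\<in>set (list_of R). twin_t M u v then R else Node v R) ys Leaf =
   list_tree (foldr (\<lambda>v R. if \<exists>u\<in>set R. twin_t M u v then R else v # R) ys [])"
  by (induction ys) auto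

lemma reps_t_eq: "list_of (reps_t M) = reps (entry M) (vertices M)"
  unfolding reps_t_def reps_def reps_t_aux by (simp add: twin_t_def)

lemma FPB_reps_t [fp]: assumes "FPB B M" shows "FPB B (\<lambda>x. reps_t (M x))"
proof (rule FPB_comp[OF _ assms])
  let ?f = "\<lambda>M v R. if \<exists>u\<in>set (list_of R). twin_t M u v then R else Node v R"
  have V: "FP verts_t" by (intro fp)
  show "FP reps_t" unfolding reps_t_def
  proof (rule FPB_foldr[OF _ V FPB_Leaf FPB_size[OF V]])
    fix M zs ys assume *: "vertices M = zs @ ys"
    have "tree_size (foldr (?f M) ys Leaf) \<le> tree_size (list_tree ys)"
      by (induction ys) auto
    also have "\<dots> \<le> tree_size (verts_t M)"
      using * by (subst (2) tree_size_list_of) (simp add: tree_size_list_tree)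
    finally show "tree_size (foldr (?f M) ys Leaf) \<le> tree_size (verts_t M)" .
  qed (intro fp)
qed

text \<open>The suffixes of the representatives give exactly the intermediate values of the fold in
  \<open>cands_t\<close>; their largest size is the quantity \<open>B\<close> for
  \<open>qk_t\<close>.\<close>

definition cands_size :: "tree \<Rightarrow> nat" where
  "cands_size M = Max ((\<lambda>i. tree_size (cands_t M (drop i (list_of (reps_t M))))) ` {..length
    (list_of (reps_t M))})"

lemma FPB_qk_t: "FPB (\<lambda>x. cands_size (left x)) qk_t"
proof -
  let ?B = "\<lambda>x. cands_size (left x)"
  have l: "FPB ?B (\<lambda>x. reps_t (left x))" by (intro fp)
  have z: "FPB ?B (\<lambda>x. Node Leaf Leaf)" by (intro fp)
  have "FPB ?B (\<lambda>x. cands_t (left x) (list_of (reps_t (left x))))"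
    unfolding cands_t_def
  proof (rule FPB_foldr[OF _ l z pb_param])
    fix x zs ys assume *: "list_of (reps_t (left x)) = zs @ ys"
    show "tree_size (foldr (extend_t (left x)) ys (Node Leaf Leaf)) \<le> cands_size (left x)"
      unfolding cands_size_def using *
      by (intro Max_ge image_eqI[of _ _ "length zs"]) (simp_all add: cands_t_def)
  qed (intro fp)
  then show ?thesis unfolding qk_t_def by (intro fp)
qed

section \<open>Correctness of the program\<close>

lemma list_of_class_t [simp]: "list_of (class_t M v) = filter (twin (entry M) (vertices M) v)
  (vertices M)"
  by (simp add: class_t_def twin_t_def)

lemma extend_t_eq:
  "map list_of (list_of (extend_t M v L)) = extend (entry M) (vertices M) v (map list_of (list_of L))"
proof -
  have i: "map list_of (list_of (indeps_t M L)) =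
    filter (\<lambda>S. indep (entry M) (set S)) (map list_of (list_of L))" for L
    unfolding indeps_t_def indep_t_def by (simp add: filter_map o_def)
  show ?thesis unfolding extend_t_def extend_def by (simp add: i o_def)
qed

lemma cands_t_eq: "map list_of (list_of (cands_t M rs)) = cands (entry M) (vertices M) rs"
  unfolding cands_t_def cands_def by (induction rs) (simp_all add: extend_t_eq)

text \<open>Subtracting twice from the length \<open>n\<close> of \<open>S\<close> yields a minimum,
  \<open>n - (n - a) = min n a\<close>. Digits are read from the most significant one, as in
  Horner's scheme, and early capping is harmless: a value that has reached \<open>n\<close> is still
  at least \<open>n\<close> after doubling.\<close>

lemma length_cap_t:
  "length (list_of (cap_t S (list_tree (map bool_tree (bits k))))) = min (length (list_of S)) k"
proof -
  let ?c = "\<lambda>ds. foldr (\<lambda>b a. drop_t (drop_t (double_t b a) S) S) ds Leaf"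
  have dbl: "length (list_of (double_t (bool_tree b) a)) = of_bool b + 2 * length (list_of a)" for b a
    by (simp add: double_t_def bool_tree_def)
  have "length (list_of (?c (map bool_tree (bits k)))) = min (length (list_of S)) k"
  proof (induction k rule: bits.induct)
    case (1 k)
    show ?case
    proof (cases "k = 0")
      case True
      then show ?thesis by (simp add: bits.simps)
    next
      case False
      have "bits k = odd k # bits (k div 2)" using False by (simp add: bits.simps)
      moreover have "k = of_bool (odd k) + 2 * (k div 2)" by (cases "odd k") simp_all
      ultimately show ?thesis using 1[OF False] by (simp add: dbl)
    qed
  qed
  then show ?thesis by (simp add: cap_t_def)
qed

lemma drop_t_Leaf: "drop_t u t = Leaf \<longleftrightarrow> length (list_of t) \<le> length (list_of u)"
proof -
  have "list_tree xs = Leaf \<longleftrightarrow> xs = []" for xs by (cases xs) auto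
  then show ?thesis by (simp add: drop_t_def)
qed

text \<open>Replacing the bound by its minimum with the length of \<open>S\<close> does not affect
  whether it is at least that length.\<close>

lemma small_t_int_tree: "small_t (int_tree q) S \<longleftrightarrow> 0 \<le> q \<and> length (list_of S) \<le> nat q"
proof -
  have "left (int_tree q) = Leaf \<longleftrightarrow> 0 \<le> q" by (auto simp: int_tree_def bool_tree_def)
  moreover have "right (int_tree q) = list_tree (map bool_tree (bits (nat \<bar>q\<bar>)))"
    by (simp add: int_tree_def)
  ultimately show ?thesis unfolding small_t_def drop_t_Leaf by (auto simp: length_cap_t drop_t_Leaf)
qed

lemma unary_tree_inject [simp]: "unary_tree i = unary_tree j \<longleftrightarrow> i = j"
  by (metis length_replicate list_of_unary)

lemma set_verts: "set (vertices M) = unary_tree ` {..<length (list_of M)}"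
  by (simp add: verts_eq atLeast0LessThan)

lemma distinct_verts: "distinct (vertices M)"
  by (simp add: verts_eq distinct_map inj_on_def)

lemma absorbs_t_eq:
  assumes "set (list_of S) \<subseteq> set (vertices M)"
  shows "absorbs_t M S \<longleftrightarrow> absorbs (entry M) (set (vertices M)) (set (list_of S))"
proof -
  have "same_length v w \<longleftrightarrow> v = w" if "v \<in> set (vertices M)" "w \<in> set (list_of S)" for v w
    using that assms by (force simp: set_verts same_length_def drop_t_Leaf)
  then show ?thesis unfolding absorbs_t_def absorbs_def by (intro ball_cong bex_cong refl) simp
qed

lemma qk_t_correct:
  "qk_t (Node M (int_tree q)) = bool_tree (0 \<le> q \<and> (\<exists>Q\<subseteq>set (vertices M). indep (entry M) Q \<and>
     absorbs (entry M) (set (vertices M)) Q \<and> card Q \<le> nat q))"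
proof -
  let ?rs = "reps (entry M) (vertices M)"
  have c: "set (cands (entry M) (vertices M) ?rs) = list_of ` set (list_of (cands_t M ?rs))"
    unfolding cands_t_eq[symmetric] by simp
  have "set (list_of S) \<subseteq> set (vertices M)" if "S \<in> set (list_of (cands_t M ?rs))" for S
    by (rule cands_elem_length(2)[OF reps_untwinned[of "entry M"] distinct_verts reps_subset])
      (use that in \<open>simp add: c\<close>)
  then show ?thesis
    unfolding cands_correct[OF distinct_verts] qk_t_def c
    by (intro arg_cong[where f = bool_tree]) (auto simp: reps_t_eq small_t_int_tree indep_t_def
      absorbs_t_eq)
qed

text \<open>A candidate has at most \<open>s\<close> vertices, each a numeral of size linear in
  \<open>s\<close>, so its encoding is quadratic in \<open>s\<close>; \<open>W\<close> bounds the
  number of candidates.\<close>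

lemma cands_size_le:
  assumes "\<And>zs rs. reps (entry M) (vertices M) = zs @ rs \<Longrightarrow> length (cands (entry M) (vertices M)
    rs) \<le> W" "0 < W"
    and n: "length (list_of M) \<le> s" "0 < s"
  shows "cands_size M \<le> 7 * W * s ^ 2"
proof -
  have "tree_size (cands_t M rs) \<le> 7 * W * s ^ 2" if *: "reps (entry M) (vertices M) = zs @ rs" for zs rs
  proof -
    have rs: "untwinned (entry M) (vertices M) rs" "set rs \<subseteq> set (vertices M)"
      using reps_untwinned[of "entry M" "vertices M"] reps_subset[of "entry M" "vertices M"]
      unfolding * by (simp_all add: sorted_wrt_append)
    have "Suc (tree_size S) \<le> 2 + s * (2 * s + 2)" if "S \<in> set (list_of (cands_t M rs))" for S
    proof -
      have "list_of S \<in> set (cands (entry M) (vertices M) rs)" using that by (simp flip: cands_t_eq)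
      note S = cands_elem_length[OF rs(1) distinct_verts rs(2) this]
      have "(\<Sum>v\<leftarrow>list_of S. Suc (tree_size v)) \<le> length (list_of S) * (2 * s + 2)"
        using S(2) n by (intro sum_list_le) (auto simp: set_verts)
      also have "\<dots> \<le> s * (2 * s + 2)" using S(1) n by (intro mult_le_mono) (simp_all add: verts_eq)
      finally show ?thesis by (subst tree_size_list_of) simp
    qed
    then have "(\<Sum>S\<leftarrow>list_of (cands_t M rs). Suc (tree_size S)) \<le> length (list_of (cands_t M rs)) *
      (2 + s * (2 * s + 2))"
      by (rule sum_list_le)
    also have "length (list_of (cands_t M rs)) = length (cands (entry M) (vertices M) rs)"
      by (simp flip: cands_t_eq)
    also have "\<dots> * (2 + s * (2 * s + 2)) \<le> W * (2 + s * (2 * s + 2))"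
      using assms(1)[OF *] by (rule mult_le_mono1)
    finally have "tree_size (cands_t M rs) \<le> 1 + W * (2 + s * (2 * s + 2))"
      by (subst tree_size_list_of) simp
    also have "\<dots> \<le> W * (3 + s * (2 * s + 2))" using assms(2) by (simp add: algebra_simps)
    \<comment> \<open>From \<open>s \<ge> 1\<close>, the summands 3, \<open>2 * s ^ 2\<close> and
      \<open>2 * s\<close> are at most 3, 2 and 2 times \<open>s ^ 2\<close>.\<close>
    also have "3 + s * (2 * s + 2) \<le> 7 * s ^ 2"
    proof -
      have "1 * s \<le> s * s" "1 * 1 \<le> s * s" using n(2) by (intro mult_le_mono; simp)+
      moreover have "s * (2 * s + 2) = 2 * (s * s) + 2 * s" by (simp add: algebra_simps)
      ultimately show ?thesis unfolding power2_eq_square by linarith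
    qed
    then have "W * (3 + s * (2 * s + 2)) \<le> W * (7 * s ^ 2)" by (rule mult_le_mono2)
    finally show ?thesis by (simp add: mult.assoc mult.left_commute)
  qed
  moreover have "reps (entry M) (vertices M) = take i (reps (entry M) (vertices M)) @ drop i (reps
    (entry M) (vertices M))" for i
    by simp
  ultimately show ?thesis unfolding cands_size_def reps_t_eq by (subst Max_le_iff) (auto simp del:
    append_take_drop_id)
qed

section \<open>Biorientations of split graphs\<close>

lemma quasi_kernel_iff:
  assumes arcs: "parcs D \<subseteq> pverts D \<times> pverts D"
  shows "quasi_kernel D Q \<longleftrightarrow> Q \<subseteq> pverts D \<and> indep (\<lambda>u v. (u, v) \<in> parcs D) Q \<and>
    absorbs (\<lambda>u v. (u, v) \<in> parcs D) (pverts D) Q"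
proof -
  have "(\<exists>p. pre_digraph.apath (with_proj D) v p w \<and> length p \<le> 2) \<longleftrightarrow>
    v = w \<or> (v, w) \<in> parcs D \<or> (\<exists>z\<in>pverts D. (v, z) \<in> parcs D \<and> (z, w) \<in> parcs D)"
    (is "?l \<longleftrightarrow> ?r") if "v \<in> pverts D" for v w
  proof
    assume ?l
    then obtain p where p: "pre_digraph.awalk (with_proj D) v p w" "length p \<le> 2"
      unfolding pre_digraph.apath_def by blast
    from p(2) consider "p = []" | a where "p = [a]" | a b where "p = [a, b]"
      by (cases p; cases "tl p") (auto simp: Suc_le_eq)
    then show ?r
      using p(1) arcs by cases (auto simp: pre_digraph.awalk_def pre_digraph.cas.simps)
  next
    assume ?r
    \<comment> \<open>A path must not repeat vertices, whereas \<open>absorbs\<close> allows it; if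
      \<open>z\<close> equals \<open>v\<close> or \<open>w\<close>, a single arc suffices.\<close>
    then consider "v = w" | "v \<noteq> w" "(v, w) \<in> parcs D"
      | z where "v \<noteq> w" "z \<noteq> v" "z \<noteq> w" "(v, z) \<in> parcs D" "(z, w) \<in> parcs D" by metis
    then show ?l
    proof cases
      case 1
      then show ?thesis using that
        by (intro exI[of _ "[]"]) (simp add: pre_digraph.apath_def pre_digraph.awalk_def
          pre_digraph.cas.simps pre_digraph.awalk_verts.simps)
    next
      case 2
      then show ?thesis using that
        by (intro exI[of _ "[(v, w)]"]) (simp add: pre_digraph.apath_def pre_digraph.awalk_def
          pre_digraph.cas.simps pre_digraph.awalk_verts.simps)
    next
      case 3
      then show ?thesis using that
        by (intro exI[of _ "[(v, z), (z, w)]"]) (simp add: pre_digraph.apath_def pre_digraph.awalk_def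
          pre_digraph.cas.simps pre_digraph.awalk_verts.simps)
    qed
  qed
  then show ?thesis unfolding quasi_kernel_def indep_def absorbs_def by auto
qed

text \<open>Transfers the answer from row indices, on which the program works, to the vertices of
  the digraph.\<close>

lemma absorbs_iso:
  assumes "bij_betw \<phi> V W" "\<And>u v. u \<in> V \<Longrightarrow> v \<in> V \<Longrightarrow> B (\<phi> u) (\<phi> v) \<longleftrightarrow> A u v"
  shows "(\<exists>Q\<subseteq>W. indep B Q \<and> absorbs B W Q \<and> card Q \<le> m) \<longleftrightarrow>
    (\<exists>Q\<subseteq>V. indep A Q \<and> absorbs A V Q \<and> card Q \<le> m)"
proof -
  have W: "W = \<phi> ` V" and inj: "inj_on \<phi> V" using assms(1) by (auto simp: bij_betw_def)
  have "indep B (\<phi> ` Q) \<longleftrightarrow> indep A Q" "absorbs B W (\<phi> ` Q) \<longleftrightarrow> absorbs A V Q" "card (\<phi> ` Q) = card Q"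
    if "Q \<subseteq> V" for Q
  proof -
    have in_V: "u \<in> Q \<Longrightarrow> u \<in> V" for u using that by blast
    show "indep B (\<phi> ` Q) \<longleftrightarrow> indep A Q" unfolding indep_def by (auto simp: assms(2) in_V)
    have "\<phi> v = \<phi> w \<longleftrightarrow> v = w" if "v \<in> V" "w \<in> Q" for v w
      using inj that in_V unfolding inj_on_def by blast
    then show "absorbs B W (\<phi> ` Q) \<longleftrightarrow> absorbs A V Q"
      unfolding absorbs_def W by (simp add: assms(2) in_V)
    show "card (\<phi> ` Q) = card Q" using inj that by (meson card_image inj_on_subset)
  qed
  note * = this
  show ?thesis
  proof
    assume "\<exists>Q\<subseteq>W. indep B Q \<and> absorbs B W Q \<and> card Q \<le> m"
    then obtain Q where "Q \<subseteq> \<phi> ` V" "indep B Q" "absorbs B W Q" "card Q \<le> m" unfolding W by blast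
    moreover from this(1) obtain Q' where "Q' \<subseteq> V" "Q = \<phi> ` Q'" unfolding subset_image_iff by blast
    ultimately show "\<exists>Q\<subseteq>V. indep A Q \<and> absorbs A V Q \<and> card Q \<le> m" using *[of Q'] by auto
  next
    assume "\<exists>Q\<subseteq>V. indep A Q \<and> absorbs A V Q \<and> card Q \<le> m"
    then obtain Q where Q: "Q \<subseteq> V" "indep A Q" "absorbs A V Q" "card Q \<le> m" by blast
    have "\<phi> ` Q \<subseteq> W" using Q(1) unfolding W by blast
    then show "\<exists>Q\<subseteq>W. indep B Q \<and> absorbs B W Q \<and> card Q \<le> m" using *[OF Q(1)] Q(2-4) by auto
  qed
qed

lemma left_drop_t: "i < length xs \<Longrightarrow> left (drop_t (unary_tree i) (list_tree xs)) = xs ! i"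
  by (simp add: drop_t_def flip: Cons_nth_drop_Suc)

lemma digraph_tree_iso:
  assumes "finite (pverts D)"
  obtains \<phi> where "bij_betw \<phi> (pverts D) (set (vertices (digraph_tree D)))"
    "\<And>u v. u \<in> pverts D \<Longrightarrow> v \<in> pverts D \<Longrightarrow> entry (digraph_tree D) (\<phi> u) (\<phi> v) \<longleftrightarrow> (u, v) \<in> parcs D"
proof -
  let ?M = "digraph_tree D"
  define vs where "vs = sorted_list_of_set (pverts D)"
  have vs: "set vs = pverts D" "distinct vs" using assms by (simp_all add: vs_def)
  have M: "?M = list_tree (map (\<lambda>u. list_tree (map (\<lambda>v. bool_tree ((u, v) \<in> parcs D)) vs)) vs)"
    unfolding digraph_tree_def Let_def vs_def ..
  have V: "set (vertices ?M) = unary_tree ` {..<length vs}" by (simp add: set_verts M)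
  have entry: "entry ?M (unary_tree i) (unary_tree j) \<longleftrightarrow> (vs ! i, vs ! j) \<in> parcs D"
    if "i < length vs" "j < length vs" for i j
    unfolding entry_def M using that by (simp add: left_drop_t bool_tree_def)
  have b: "bij_betw ((!) vs) {..<length vs} (pverts D)"
    using bij_betw_nth[OF vs(2) refl vs(1)[symmetric]] .
  \<comment> \<open>\<open>\<iota>\<close> is the rank of a vertex in the sorted list, that is, the
    number of its row.\<close>
  define \<iota> where "\<iota> = the_inv_into {..<length vs} ((!) vs)"
  have \<iota>: "bij_betw \<iota> (pverts D) {..<length vs}" unfolding \<iota>_def by (rule bij_betw_the_inv_into[OF b])
  have nth: "\<iota> u < length vs" "vs ! \<iota> u = u" if "u \<in> pverts D" for u
    using bij_betwE[OF \<iota>] that f_the_inv_into_f_bij_betw[OF b] unfolding \<iota>_def by auto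
  show thesis
  proof (rule that[of "unary_tree \<circ> \<iota>"])
    show "bij_betw (unary_tree \<circ> \<iota>) (pverts D) (set (vertices ?M))"
      unfolding V by (rule bij_betw_trans[OF \<iota>]) (simp add: bij_betw_def inj_on_def)
    show "entry ?M ((unary_tree \<circ> \<iota>) u) ((unary_tree \<circ> \<iota>) v) \<longleftrightarrow> (u, v) \<in> parcs D"
      if "u \<in> pverts D" "v \<in> pverts D" for u v
      using entry[OF nth(1)[OF that(1)] nth(1)[OF that(2)]] nth(2) that by simp
  qed
qed

lemma split_instance:
  assumes "split_graph G" "biorientation G D" "split_partition G K I"
  shows "finite (pverts D)" "parcs D \<subseteq> pverts D \<times> pverts D" "pverts D = K \<union> I" "K \<inter> I = {}"
    "\<And>u v. u \<in> K \<Longrightarrow> v \<in> K \<Longrightarrow> u \<noteq> v \<Longrightarrow> (u, v) \<in> parcs D \<or> (v, u) \<in> parcs D"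
    "\<And>u v. u \<in> I \<Longrightarrow> v \<in> I \<Longrightarrow> (u, v) \<notin> parcs D"
proof -
  interpret pair_graph G using assms(1) by (simp add: split_graph_def)
  show "finite (pverts D)" using assms(2) by (simp add: biorientation_def)
  show "parcs D \<subseteq> pverts D \<times> pverts D"
    using assms(2) arc_fst_in_verts arc_snd_in_verts unfolding biorientation_def by fastforce
qed (use assms(2,3) in \<open>auto simp: biorientation_def split_partition_def\<close>)

lemma qk_t_decides:
  assumes "x \<in> split_instances"
  shows "qk_t (qk_tree x) = bool_tree (has_small_qk x)"
proof -
  obtain D q where x: "x = (D, q)" by (cases x)
  from assms obtain G K I where G: "split_graph G" "biorientation G D" "split_partition G K I"
    unfolding x split_instances_def split_graph_def by blast
  note D = split_instance[OF G]
  obtain \<phi> where \<phi>: "bij_betw \<phi> (pverts D) (set (vertices (digraph_tree D)))"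
    "\<And>u v. u \<in> pverts D \<Longrightarrow> v \<in> pverts D \<Longrightarrow> entry (digraph_tree D) (\<phi> u) (\<phi> v) \<longleftrightarrow> (u, v) \<in> parcs D"
    using digraph_tree_iso[OF D(1)] by blast
  have "has_small_qk x \<longleftrightarrow> 0 \<le> q \<and> (\<exists>Q\<subseteq>pverts D. indep (\<lambda>u v. (u, v) \<in> parcs D) Q \<and>
      absorbs (\<lambda>u v. (u, v) \<in> parcs D) (pverts D) Q \<and> card Q \<le> nat q)"
  proof -
    have "int (card Q) \<le> q \<longleftrightarrow> 0 \<le> q \<and> card Q \<le> nat q" for Q :: "nat set" by linarith
    then show ?thesis unfolding has_small_qk_def x prod.case quasi_kernel_iff[OF D(2)] by blast
  qed
  moreover have "(\<exists>Q\<subseteq>set (vertices (digraph_tree D)). indep (entry (digraph_tree D)) Q \<and>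
      absorbs (entry (digraph_tree D)) (set (vertices (digraph_tree D))) Q \<and> card Q \<le> m) \<longleftrightarrow>
    (\<exists>Q\<subseteq>pverts D. indep (\<lambda>u v. (u, v) \<in> parcs D) Q \<and>
      absorbs (\<lambda>u v. (u, v) \<in> parcs D) (pverts D) Q \<and> card Q \<le> m)" for m
    by (rule absorbs_iso[OF \<phi>(1)]) (rule \<phi>(2))
  ultimately show ?thesis unfolding x qk_tree_def prod.case qk_t_correct by simp
qed

lemma cands_size_split:
  assumes G: "split_graph G" "biorientation G D" "split_partition G K I"
  shows "cands_size (digraph_tree D) \<le> 7 * 3 ^ (card K + 4 ^ card K) * tree_size (qk_tree (D, q)) ^ 3"
    and "cands_size (digraph_tree D) \<le> 21 * 3 ^ card I * tree_size (qk_tree (D, q)) ^ 3"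
proof -
  let ?M = "digraph_tree D" and ?s = "tree_size (qk_tree (D, q))"
  let ?A = "entry ?M" and ?vs = "vertices ?M"
  note D = split_instance[OF G]
  obtain \<phi> where \<phi>: "bij_betw \<phi> (pverts D) (set ?vs)"
    "\<And>u v. u \<in> pverts D \<Longrightarrow> v \<in> pverts D \<Longrightarrow> ?A (\<phi> u) (\<phi> v) \<longleftrightarrow> (u, v) \<in> parcs D"
    using digraph_tree_iso[OF D(1)] by blast
  have inj: "inj_on \<phi> (pverts D)" and im: "set ?vs = \<phi> ` K \<union> \<phi> ` I"
    using \<phi>(1) unfolding bij_betw_def D(3) by auto
  have card_K: "card (\<phi> ` K) = card K" and card_I: "card (\<phi> ` I) = card I"
    using inj unfolding D(3) by (auto intro!: card_image intro: inj_on_subset)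
  have clique: "?A u v \<or> ?A v u" if "u \<in> \<phi> ` K" "v \<in> \<phi> ` K" "u \<noteq> v" for u v
  proof -
    from that obtain a b where "a \<in> K" "b \<in> K" "u = \<phi> a" "v = \<phi> b" "a \<noteq> b" by auto
    then show ?thesis using D(5)[of a b] \<phi>(2) unfolding D(3) by auto
  qed
  have ind: "\<not> ?A u v" if "u \<in> \<phi> ` I" "v \<in> \<phi> ` I" for u v
    using that D(3,6) \<phi>(2) by auto
  have s: "length (list_of ?M) < ?s"
    using length_list_of[of ?M] by (simp add: qk_tree_def)
  have suffix: "untwinned ?A ?vs rs" "set rs \<subseteq> set ?vs" if "reps ?A ?vs = zs @ rs" for zs rs
    using reps_untwinned[of ?A ?vs] reps_subset[of ?A ?vs] unfolding that
    by (simp_all add: sorted_wrt_append)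
  show "cands_size ?M \<le> 7 * 3 ^ (card K + 4 ^ card K) * ?s ^ 3"
  proof -
    have "cands_size ?M \<le> 7 * 3 ^ (card K + 4 ^ card K) * ?s ^ 2"
    proof (rule cands_size_le)
      fix zs rs assume *: "reps ?A ?vs = zs @ rs"
      have "length (cands ?A ?vs rs) \<le> 3 ^ length rs" by (rule length_cands)
      also have "\<dots> \<le> 3 ^ (card K + 4 ^ card K)"
        using length_untwinned_clique[OF ind im suffix[OF *]] unfolding card_K
        by (intro power_increasing) simp_all
      finally show "length (cands ?A ?vs rs) \<le> 3 ^ (card K + 4 ^ card K)" .
    qed (use s in auto)
    also have "\<dots> \<le> 7 * 3 ^ (card K + 4 ^ card K) * ?s ^ 3"
      using s by (intro mult_le_mono2 power_increasing) simp_all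
    finally show ?thesis .
  qed
  show "cands_size ?M \<le> 21 * 3 ^ card I * ?s ^ 3"
  proof -
    \<comment> \<open>The number of clique representatives is below \<open>?s\<close>, so
      \<open>1 + 2 * k\<close> is at most \<open>3 * ?s\<close>; this factor turns 7 into 21 and the
      square into a cube.\<close>
    have "cands_size ?M \<le> 7 * (3 ^ card I * (3 * ?s)) * ?s ^ 2"
    proof (rule cands_size_le)
      fix zs rs assume *: "reps ?A ?vs = zs @ rs"
      note rs = suffix[OF *]
      have "distinct rs" by (rule untwinned_distinct[OF rs(1)])
      have "length (filter (\<lambda>v. v \<notin> \<phi> ` K) rs) = card (set rs - \<phi> ` K)"
        using distinct_card[of "filter (\<lambda>v. v \<notin> \<phi> ` K) rs"] \<open>distinct rs\<close> by (simp add: set_diff_eq)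
      also have "\<dots> \<le> card (\<phi> ` I)"
        using rs(2) D(1) unfolding im D(3) by (intro card_mono) auto
      finally have i: "length (filter (\<lambda>v. v \<notin> \<phi> ` K) rs) \<le> card I" unfolding card_I .
      have "length rs \<le> length ?vs"
        using card_mono[OF _ rs(2)] \<open>distinct rs\<close> distinct_verts[of ?M] by (simp add: distinct_card)
      moreover have "length ?vs = length (list_of ?M)" by (simp add: verts_eq)
      ultimately have k: "length (filter (\<lambda>v. v \<in> \<phi> ` K) rs) < ?s"
        using length_filter_le[of "\<lambda>v. v \<in> \<phi> ` K" rs] s by linarith
      have "length (cands ?A ?vs rs) \<le> 3 ^ length (filter (\<lambda>v. v \<notin> \<phi> ` K) rs)
          * (1 + 2 * length (filter (\<lambda>v. v \<in> \<phi> ` K) rs))"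
        using length_cands_indep[OF clique im rs(1) distinct_verts rs(2)] by blast
      also have "\<dots> \<le> 3 ^ card I * (3 * ?s)"
        using i k by (intro mult_le_mono power_increasing) simp_all
      finally show "length (cands ?A ?vs rs) \<le> 3 ^ card I * (3 * ?s)" .
    qed (use s in auto)
    then show ?thesis by (simp add: power3_eq_cube power2_eq_square mult_ac)
  qed
qed

theorem proposition4p2:
  fixes K I :: "nat pair_pre_digraph \<Rightarrow> nat set"
  assumes "\<And>G D. split_graph G \<Longrightarrow> biorientation G D \<Longrightarrow> split_partition G (K D) (I D)"
  shows "fpt qk_tree split_instances has_small_qk (\<lambda>(D, q). card (K D)) \<and>
         fpt qk_tree split_instances has_small_qk (\<lambda>(D, q). card (I D))"
proof
  \<comment> \<open>Both halves use the same function \<open>qk_t\<close>; only the estimate for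
    \<open>cands_size\<close> differs.\<close>
  show "fpt qk_tree split_instances has_small_qk (\<lambda>(D, q). card (K D))"
  proof (rule FPB_fpt[OF FPB_qk_t _ qk_t_decides])
    show "computable_on_unary (\<lambda>k. 7 * 3 ^ (k + 4 ^ k))"
      by (intro computable_mult computable_power computable_add computable_const computable_id)
    fix x assume "x \<in> split_instances"
    then obtain D q G where G: "x = (D, q)" "split_graph G" "biorientation G D"
      unfolding split_instances_def by blast
    show "cands_size (left (qk_tree x)) \<le> 7 * 3 ^ ((case x of (D, q) \<Rightarrow> card (K D)) +
        4 ^ (case x of (D, q) \<Rightarrow> card (K D))) * tree_size (qk_tree x) ^ 3"
      using cands_size_split(1)[OF G(2,3) assms[OF G(2,3)], of q] by (simp add: qk_tree_def G(1))
  qed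
  show "fpt qk_tree split_instances has_small_qk (\<lambda>(D, q). card (I D))"
  proof (rule FPB_fpt[OF FPB_qk_t _ qk_t_decides])
    show "computable_on_unary (\<lambda>k. 21 * 3 ^ k)"
      by (intro computable_mult computable_power computable_const computable_id)
    fix x assume "x \<in> split_instances"
    then obtain D q G where G: "x = (D, q)" "split_graph G" "biorientation G D"
      unfolding split_instances_def by blast
    show "cands_size (left (qk_tree x)) \<le> 21 * 3 ^ (case x of (D, q) \<Rightarrow> card (I D)) *
        tree_size (qk_tree x) ^ 3"
      using cands_size_split(2)[OF G(2,3) assms[OF G(2,3)], of q] by (simp add: qk_tree_def G(1))
  qed
qed

end
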